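(* Let $k$ be a commutative ring with unity endowed with a real valuation $\nu$, and let $R$ be an arbitrary commutative $k$-algebra with unity. Denote by $\mathcal{V}(R,k)$ the set of all real ring valuations of $R$ that extend $\nu$. Then there exist a $k$-algebra $K$ and a real valuation $\mu$ on $K$ such that $\mu|_k=\nu$, and for every $v\in\mathcal{V}(R,k)$ there exists a morphism $f_v\colon R\to K$ of $k$-algebras such that $v=\mu\circ f_v$.
   Context: All algebras are commutative with unity. A real (rank one) valuation on a commutative ring $R$ with unity is a function $v\colon R\to\mathbb{R}\cup\{+\infty\}$ such that $v(1)=0$, $v(0)=+\infty$, $v(xy)=v(x)+v(y)$ and $v(x+y)\ge\min\{v(x),v(y)\}$ for all $x,y\in R$ (the value $+\infty$ may be taken on nonzero elements). If $B$ is an $A$-algebra and $v$ is a valuation of $B$, the restriction $v|_A$ is the composition of $v$ with the structure map $A\to B$; $v$ extends a valuation $\nu$ of $A$ if $v|_A=\nu$. *)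

theory Defs
  imports
    "HOL-Algebra.Module"
    "HOL-Library.Extended_Real"
    "HOL-Library.Poly_Mapping"
begin

text \<open>
  A \<open>k\<close>-algebra is an instance of the locale \<^locale>\<open>algebra\<close>, i.e. it is given by a scalar
  multiplication \<open>\<odot>\<close>; its structure map is \<open>a \<mapsto> a \<odot> \<one>\<close>. Functions on a ring are total
  on the underlying type but only meaningful on the carrier, so all conditions on them, including
  equality of valuations, are relativised to the carrier.
\<close>

locale real_valuation = cring +
  fixes v :: "'a \<Rightarrow> ereal"
  assumes val_not_MInf: "x \<in> carrier R \<Longrightarrow> v x \<noteq> -\<infinity>"
    and val_one: "v \<one> = 0"
    and val_zero: "v \<zero> = \<infinity>"
    and val_mult: "\<lbrakk>x \<in> carrier R; y \<in> carrier R\<rbrakk> \<Longrightarrow> v (x \<otimes> y) = v x + v y"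
    and val_add: "\<lbrakk>x \<in> carrier R; y \<in> carrier R\<rbrakk> \<Longrightarrow> v (x \<oplus> y) \<ge> min (v x) (v y)"

definition structure_map :: "('a, 'b, 'm) module_scheme \<Rightarrow> 'a \<Rightarrow> 'b" where
  "structure_map B a = a \<odot>\<^bsub>B\<^esub> \<one>\<^bsub>B\<^esub>"

definition val_restrict :: "('a, 'b, 'm) module_scheme \<Rightarrow> ('b \<Rightarrow> ereal) \<Rightarrow> 'a \<Rightarrow> ereal" where
  "val_restrict B v = v \<circ> structure_map B"

definition extends_val ::
  "('a, 'l) ring_scheme \<Rightarrow> ('a \<Rightarrow> ereal) \<Rightarrow> ('a, 'b, 'm) module_scheme \<Rightarrow> ('b \<Rightarrow> ereal) \<Rightarrow> bool" where
  "extends_val A \<nu> B v \<longleftrightarrow> (\<forall>a\<in>carrier A. val_restrict B v a = \<nu> a)"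

definition val_extensions ::
  "('a, 'l) ring_scheme \<Rightarrow> ('a \<Rightarrow> ereal) \<Rightarrow> ('a, 'b, 'm) module_scheme \<Rightarrow> ('b \<Rightarrow> ereal) set" where
  "val_extensions k \<nu> R = {v. real_valuation R v \<and> extends_val k \<nu> R v}"

definition algebra_hom ::
  "('a, 'l) ring_scheme \<Rightarrow> ('a, 'b, 'm) module_scheme \<Rightarrow> ('a, 'c, 'n) module_scheme \<Rightarrow> ('b \<Rightarrow> 'c) set"
  where
  "algebra_hom k R K =
    {f \<in> ring_hom R K. \<forall>a\<in>carrier k. \<forall>x\<in>carrier R. f (a \<odot>\<^bsub>R\<^esub> x) = a \<odot>\<^bsub>K\<^esub> f x}"

text \<open>
  HOL cannot quantify existentially over types, so the algebra \<open>K\<close> needs a type of elements fixed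
  in terms of the types \<open>'a\<close> of \<open>k\<close> and \<open>'b\<close> of \<open>R\<close>. The type below is large enough for this not to be
  a restriction: the subring of a \<open>k\<close>-algebra generated by the image of \<open>k\<close> and the images of
  homomorphisms \<open>f v\<close> from \<open>R\<close>, one for each valuation \<open>v\<close>, is a quotient of the polynomial ring over
  the integers with one variable \<open>Inl a\<close> for each \<open>a\<close> in \<open>k\<close> and one variable \<open>Inr (v, r)\<close> for each
  \<open>v\<close> and each \<open>r\<close> in \<open>R\<close>. Elements of the type are sets of such polynomials, e.g. cosets.
\<close>

type_synonym ('a, 'b) coset_type =
  "((('a + ('b \<Rightarrow> ereal) \<times> 'b) \<Rightarrow>\<^sub>0 nat) \<Rightarrow>\<^sub>0 int) set"

end

theory Submission
  imports Defs
begin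

text \<open>
  Write valuations as multiplicative norms \<open>exp (- v)\<close>. Let \<open>A\<close> be the integral polynomial ring
  on the elements of \<open>k\<close> and \<open>C = A[X]\<close> with one variable for each element of \<open>R\<close>; then \<open>\<nu>\<close>
  is a multiplicative seminorm on \<open>A\<close>, and every \<open>v\<close> extending \<open>\<nu>\<close> is one on \<open>C\<close>. The tensor
  product over \<open>A\<close> of one copy of \<open>C\<close> for each \<open>v\<close> carries the projective tensor seminorm. On pure
  tensors it takes the expected value: products of linear functionals on the factors, provided
  by a finite Hahn-Banach lemma, bound it from below. Among the submultiplicative seminorms below
  it with the same values on pure tensors, a minimal one exists by Zorn's lemma, and it is
  multiplicative. The algebra \<open>K\<close> is the quotient by the elements of norm \<open>0\<close>.
\<close>

subsection \<open>Minimal seminorms\<close>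

text \<open>Polynomial rings take the place of \<open>k\<close> and \<open>R\<close> because
  \<open>A[X]\<close> is free over \<open>A\<close>: a tensor product of copies is again a
  polynomial ring, and a linear functional is an arbitrary choice of one value per monomial. The
  relations of \<open>k\<close> and \<open>R\<close> are not imposed but hold up to elements of norm
  0. The price is that \<open>A\<close> has few inverses and its seminorm has a kernel, so
  functionals must be built without dividing in \<open>A\<close>. The obstacle is that rewriting a
  pure tensor as a combination of others might lower its norm. Excluding this takes functionals that
  attain the norm exactly. In infinite dimension over a field that is not spherically complete these
  can fail to exist, but one rewriting involves only finitely many vectors, and among these a
  minimum is attained. Minimality gives multiplicativity through competitors: inverting an element,
  or adjusting the norm of an element to the norm of its square, yields a seminorm below the given
  one with the same prescribed values, hence the same seminorm.\<close>

locale ring_seminorm =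
  fixes N :: "'a::comm_ring_1 \<Rightarrow> real"
  assumes zero [simp]: "N 0 = 0"
    and nonneg [simp]: "0 \<le> N x"
    and diff_le: "N (x - y) \<le> max (N x) (N y)"
    and mult_le: "N (x * y) \<le> N x * N y"
begin

lemma minus [simp]: "N (- x) = N x"
  using diff_le[of 0 x] diff_le[of 0 "- x"] by simp

lemma add_le: "N (x + y) \<le> max (N x) (N y)"
  using diff_le[of x "- y"] by simp

end

locale mult_seminorm = ring_seminorm +
  assumes one [simp]: "N 1 = 1"
    and mult: "N (x * y) = N x * N y"
begin

lemma prod: "N (prod f I) = (\<Prod>i\<in>I. N (f i))"
  by (induction I rule: infinite_finite_induct) (simp_all add: mult)

lemma eq_of_diff_zero:
  assumes "N (x - y) = 0"
  shows "N x = N y"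
proof -
  have "N x \<le> max (N (x - y)) (N y)" using add_le[of "x - y" y] by simp
  moreover have "N y \<le> max (N x) (N (x - y))" using diff_le[of x "x - y"] by simp
  ultimately show ?thesis using assms nonneg[of x] nonneg[of y] by linarith
qed

end

text \<open>\<open>U x c\<close> is to be read as: \<open>c\<close> is an admissible upper bound for the norm of \<open>x\<close>.\<close>

locale gauge_rel =
  fixes U :: "'a::comm_ring_1 \<Rightarrow> real \<Rightarrow> bool"
  assumes nonneg: "U x c \<Longrightarrow> 0 \<le> c"
    and ex: "\<exists>c. U x c"
    and zero: "U 0 0"
    and diff: "U x c \<Longrightarrow> U y d \<Longrightarrow> U (x - y) (max c d)"
    and mult: "U x c \<Longrightarrow> U y d \<Longrightarrow> U (x * y) (c * d)"
begin

definition gauge :: "'a \<Rightarrow> real" where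
  "gauge x = Inf {c. U x c}"

lemma gauge_le: "U x c \<Longrightarrow> gauge x \<le> c"
  unfolding gauge_def by (rule cInf_lower) (auto intro!: bdd_belowI[of _ 0] nonneg)

lemma gauge_ge: "(\<And>c. U x c \<Longrightarrow> b \<le> c) \<Longrightarrow> b \<le> gauge x"
  unfolding gauge_def using ex by (intro cInf_greatest) auto

lemma gauge_less: "gauge x < b \<Longrightarrow> \<exists>c<b. U x c"
  by (rule ccontr) (use gauge_ge[of x b] in \<open>auto simp: not_less[symmetric]\<close>)

sublocale ring_seminorm gauge
proof
  show nn: "0 \<le> gauge x" for x by (rule gauge_ge) (rule nonneg)
  show "gauge 0 = 0" using gauge_le[OF zero] nn[of 0] by simp
  show "gauge (x - y) \<le> max (gauge x) (gauge y)" for x y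
  proof (rule dense_ge)
    fix b assume "max (gauge x) (gauge y) < b"
    then obtain c d where "c < b" "U x c" "d < b" "U y d"
      using gauge_less[of x b] gauge_less[of y b] by auto
    then show "gauge (x - y) \<le> b" using gauge_le[OF diff[of x c y d]] by simp
  qed
  show "gauge (x * y) \<le> gauge x * gauge y" for x y
  proof (rule tendsto_lowerbound)
    show "((\<lambda>e. (gauge x + e) * (gauge y + e)) \<longlongrightarrow> gauge x * gauge y) (at_right 0)"
      by (auto intro!: tendsto_eq_intros)
    show "\<forall>\<^sub>F e in at_right 0. gauge (x * y) \<le> (gauge x + e) * (gauge y + e)"
      using eventually_at_right_less
    proof eventually_elim
      fix e :: real assume "0 < e"
      then obtain c d where cd: "c < gauge x + e" "U x c" "d < gauge y + e" "U y d"
        using gauge_less[of x "gauge x + e"] gauge_less[of y "gauge y + e"] by auto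
      have "gauge (x * y) \<le> c * d" by (rule gauge_le) (rule mult cd)+
      also have "\<dots> \<le> (gauge x + e) * (gauge y + e)"
        using cd nonneg[OF cd(2)] nonneg[OF cd(4)] by (intro mult_mono) auto
      finally show "gauge (x * y) \<le> (gauge x + e) * (gauge y + e)" .
    qed
  qed simp
qed

end

text \<open>The weight \<open>w\<close> is the norm prescribed for \<open>s\<close>. It has to be
  positive because localization divides by it; pure tensors of norm 0 are therefore kept out of the
  monoid and are treated separately in \<open>amalgamation\<close>.\<close>

definition weighted_monoid :: "('a::comm_ring_1 \<times> real) set \<Rightarrow> bool" where
  "weighted_monoid S \<longleftrightarrow> (1, 1) \<in> S \<and> (\<forall>(s, w)\<in>S. 0 < w \<and> (\<forall>(t, u)\<in>S. (s * t, w * u) \<in> S))"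

lemma weighted_monoidD:
  assumes "weighted_monoid S"
  shows "(1, 1) \<in> S" "(s, w) \<in> S \<Longrightarrow> 0 < w" "(s, w) \<in> S \<Longrightarrow> (t, u) \<in> S \<Longrightarrow> (s * t, w * u) \<in> S"
  using assms unfolding weighted_monoid_def by auto

text \<open>Inverting every \<open>s\<close> and giving its inverse the norm \<open>1 / w\<close>
  leads to the infimum of \<open>N (s * x) / w\<close>; the last two clauses say that
  \<open>L\<close> is this infimum. It serves as a competitor of a minimal seminorm, with
  \<open>S\<close> the prescribed monoid itself and with \<open>S\<close> the powers of one
  element.\<close>

lemma localized_seminorm:
  assumes "ring_seminorm N" and S: "weighted_monoid S"
    and le: "\<And>s w. (s, w) \<in> S \<Longrightarrow> N s \<le> w"
  obtains L where "ring_seminorm L" "\<And>x. L x \<le> N x"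
    "\<And>x s w. (s, w) \<in> S \<Longrightarrow> L x \<le> N (s * x) / w"
    "\<And>x b. (\<And>s w. (s, w) \<in> S \<Longrightarrow> b \<le> N (s * x) / w) \<Longrightarrow> b \<le> L x"
proof -
  interpret N: ring_seminorm N by fact
  note S_one = weighted_monoidD(1)[OF S] and S_pos = weighted_monoidD(2)[OF S]
    and S_mult = weighted_monoidD(3)[OF S]
  define U where "U x c \<longleftrightarrow> (\<exists>(s, w)\<in>S. N (s * x) \<le> c * w)" for x c
  have UI: "U x c" if "(s, w) \<in> S" "N (s * x) \<le> c * w" for x c s w
    using that unfolding U_def by blast
  interpret gauge_rel U
  proof
    fix x c assume "U x c"
    then obtain s w where sw: "(s, w) \<in> S" "N (s * x) \<le> c * w" unfolding U_def by blast
    then have "0 \<le> c * w" using N.nonneg[of "s * x"] by linarith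
    then show "0 \<le> c" using S_pos[OF sw(1)] by (simp add: zero_le_mult_iff)
  next
    fix x show "\<exists>c. U x c" using UI[OF S_one, of x "N x"] by auto
  next
    show "U 0 0" using UI[OF S_one, of 0 0] by simp
  next
    fix x c y d assume "U x c" "U y d"
    then obtain s w t u where *: "(s, w) \<in> S" "N (s * x) \<le> c * w" "(t, u) \<in> S" "N (t * y) \<le> d * u"
      unfolding U_def by blast
    note w = S_pos[OF *(1)] S_pos[OF *(3)]
    \<comment> \<open>The product \<open>s * t\<close> is a common denominator: each bound is
      carried over to it by submultiplicativity and \<open>le\<close>.\<close>
    have 1: "N (s * t * x) \<le> c * (w * u)"
    proof -
      have "N (s * t * x) \<le> N t * N (s * x)" using N.mult_le[of t "s * x"] by (simp add: mult_ac)
      also have "\<dots> \<le> u * (c * w)" using le *(1-3) w by (intro mult_mono) auto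
      finally show ?thesis by (simp add: mult_ac)
    qed
    have 2: "N (s * t * y) \<le> d * (w * u)"
    proof -
      have "N (s * t * y) \<le> N s * N (t * y)" using N.mult_le[of s "t * y"] by (simp add: mult_ac)
      also have "\<dots> \<le> w * (d * u)" using le * w by (intro mult_mono) auto
      finally show ?thesis by (simp add: mult_ac)
    qed
    have "N (s * t * (x - y)) \<le> max c d * (w * u)"
    proof -
      have "N (s * t * (x - y)) \<le> max (N (s * t * x)) (N (s * t * y))"
        using N.diff_le by (simp add: right_diff_distrib)
      also have "\<dots> \<le> max c d * (w * u)" using 1 2 w by (auto simp: max_mult_distrib_right)
      finally show ?thesis .
    qed
    then show "U (x - y) (max c d)" using UI S_mult * by blast
    have "N (s * t * (x * y)) \<le> N (s * x) * N (t * y)"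
      using N.mult_le[of "s * x" "t * y"] by (simp add: mult_ac)
    also have "\<dots> \<le> (c * w) * (d * u)" using * by (intro mult_mono) (auto intro: order_trans[OF N.nonneg])
    finally have "N (s * t * (x * y)) \<le> (c * d) * (w * u)" by (simp add: mult_ac)
    then show "U (x * y) (c * d)" using UI S_mult * by blast
  qed
  show thesis
  proof
    show "ring_seminorm gauge" by unfold_locales
    show "gauge x \<le> N x" for x using UI[OF S_one, of x "N x"] by (intro gauge_le) simp
    show "gauge x \<le> N (s * x) / w" if "(s, w) \<in> S" for x s w
      using that S_pos[OF that] by (intro gauge_le UI) auto
    show "b \<le> gauge x" if b: "\<And>s w. (s, w) \<in> S \<Longrightarrow> b \<le> N (s * x) / w" for x b
    proof (rule gauge_ge)
      fix c assume "U x c"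
      then obtain s w where sw: "(s, w) \<in> S" "N (s * x) \<le> c * w" unfolding U_def by blast
      have "N (s * x) / w \<le> c" using sw S_pos[OF sw(1)] by (simp add: divide_le_eq)
      then show "b \<le> c" using b[OF sw(1)] by linarith
    qed
  qed
qed

text \<open>
  The new norm is the quotient norm on \<open>A + A y\<close>, where \<open>y\<close> is given the norm \<open>sqrt (N (y * y))\<close>.
  It still takes the value \<open>w\<close> on \<open>s\<close>: if \<open>s = a + b * y\<close> had smaller norm, then so would
  \<open>s\<^sup>2 = 2 * s * a - a\<^sup>2 + b\<^sup>2 * y\<^sup>2\<close>.
\<close>

lemma square_adjusted_seminorm:
  assumes "ring_seminorm N" and T: "weighted_monoid T"
    and eq: "\<And>s w. (s, w) \<in> T \<Longrightarrow> N s = w"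
  obtains L where "ring_seminorm L" "\<And>x. L x \<le> N x" "\<And>s w. (s, w) \<in> T \<Longrightarrow> L s = w"
    "(L y)\<^sup>2 \<le> N (y * y)"
proof -
  interpret N: ring_seminorm N by fact
  define r where "r = sqrt (N (y * y))"
  have r: "0 \<le> r" "r * r = N (y * y)" unfolding r_def by simp_all
  define U where "U x c \<longleftrightarrow> (\<exists>a b. x = a + b * y \<and> N a \<le> c \<and> r * N b \<le> c)" for x c
  interpret gauge_rel U
  proof
    fix x c assume "U x c"
    then show "0 \<le> c" unfolding U_def using N.nonneg order_trans by blast
  next
    fix x have "U x (N x)" unfolding U_def by (intro exI[of _ x] exI[of _ 0]) simp
    then show "\<exists>c. U x c" ..
  next
    show "U 0 0" unfolding U_def by (intro exI[of _ 0]) simp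
  next
    fix x c x' d assume "U x c" "U x' d"
    then obtain a b a' b' where *: "x = a + b * y" "N a \<le> c" "r * N b \<le> c"
      "x' = a' + b' * y" "N a' \<le> d" "r * N b' \<le> d" unfolding U_def by blast
    have c: "0 \<le> c" "0 \<le> d" using * N.nonneg order_trans by blast+
    have "r * N (b - b') \<le> r * max (N b) (N b')" by (intro mult_left_mono N.diff_le r)
    also have "\<dots> \<le> max c d" using * by (auto simp: max_def)
    finally have "r * N (b - b') \<le> max c d" .
    moreover have "N (a - a') \<le> max c d" using N.diff_le[of a a'] * by linarith
    moreover have "x - x' = (a - a') + (b - b') * y" using * by (simp add: algebra_simps)
    ultimately show "U (x - x') (max c d)" unfolding U_def by blast
    have 1: "N (a * a' + b * b' * (y * y)) \<le> c * d"
    proof -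
      have "N (a * a') \<le> c * d"
        using N.mult_le[of a a'] mult_mono[OF *(2,5)] c by simp
      moreover have "N (b * b' * (y * y)) \<le> c * d"
      proof -
        have "N (b * b' * (y * y)) \<le> N b * N b' * N (y * y)"
          by (intro order_trans[OF N.mult_le] mult_right_mono N.mult_le) simp
        also have "\<dots> = (r * N b) * (r * N b')" by (simp add: r(2)[symmetric] mult_ac)
        also have "\<dots> \<le> c * d" using * c r by (intro mult_mono) auto
        finally show ?thesis .
      qed
      ultimately show ?thesis using N.add_le[of "a * a'" "b * b' * (y * y)"] by linarith
    qed
    have 2: "r * N (a * b' + a' * b) \<le> c * d"
    proof -
      have "r * N (a * b') \<le> r * (N a * N b')" by (intro mult_left_mono N.mult_le r)
      also have "\<dots> = N a * (r * N b')" by simp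
      also have "\<dots> \<le> c * d" using * c r by (intro mult_mono) auto
      finally have i: "r * N (a * b') \<le> c * d" .
      have "r * N (a' * b) \<le> r * (N a' * N b)" by (intro mult_left_mono N.mult_le r)
      also have "\<dots> = (r * N b) * N a'" by simp
      also have "\<dots> \<le> c * d" using * c r by (intro mult_mono) auto
      finally have ii: "r * N (a' * b) \<le> c * d" .
      have "r * N (a * b' + a' * b) \<le> r * max (N (a * b')) (N (a' * b))"
        by (intro mult_left_mono N.add_le r)
      also have "\<dots> \<le> c * d" using i ii by (auto simp: max_def)
      finally show ?thesis .
    qed
    have "x * x' = (a * a' + b * b' * (y * y)) + (a * b' + a' * b) * y"
      using * by (simp add: algebra_simps)
    then show "U (x * x') (c * d)" unfolding U_def using 1 2 by blast
  qed
  have le: "gauge x \<le> N x" for x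
    by (rule gauge_le) (unfold U_def, intro exI[of _ x] exI[of _ 0], simp)
  show thesis
  proof
    show "ring_seminorm gauge" by unfold_locales
    show "gauge x \<le> N x" for x by (rule le)
    have "gauge y * gauge y \<le> N (y * y)" if "N 1 = 1"
    proof -
      have "U y r" unfolding U_def by (intro exI[of _ 0] exI[of _ 1]) (simp add: that r)
      then have "gauge y \<le> r" by (rule gauge_le)
      then show ?thesis using r mult_mono[of "gauge y" r "gauge y" r] by simp
    qed
    then show "(gauge y)\<^sup>2 \<le> N (y * y)"
      using eq[OF weighted_monoidD(1)[OF T]] by (simp add: power2_eq_square)
    fix s w assume sw: "(s, w) \<in> T"
    have w: "0 < w" "N s = w" "N (s * s) = w * w"
      using weighted_monoidD(2,3)[OF T] eq sw by blast+
    have "w \<le> gauge s"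
    proof (rule gauge_ge, rule ccontr)
      fix c assume "U s c" and "\<not> w \<le> c"
      then obtain a b where ab: "s = a + b * y" "N a < w" "r * N b < w" unfolding U_def by force
      have i: "N (s * a) < w * w"
        using N.mult_le[of s a] mult_strict_left_mono[OF ab(2) w(1)] w(2) by simp
      have "N a * N a < w * w" using ab w by (intro mult_strict_mono) auto
      then have ii: "N (a * a) < w * w" using N.mult_le[of a a] by linarith
      have "N (b * b * (y * y)) \<le> N b * N b * N (y * y)"
        by (intro order_trans[OF N.mult_le] mult_right_mono N.mult_le) simp
      also have "\<dots> = (r * N b) * (r * N b)" by (simp add: r(2)[symmetric] mult_ac)
      also have "\<dots> < w * w" using ab w r by (intro mult_strict_mono) auto
      finally have iii: "N (b * b * (y * y)) < w * w" .
      have "s * s = ((s * a + s * a) - a * a) + b * b * (y * y)"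
        unfolding ab(1) by (simp add: algebra_simps)
      then have "N (s * s) < w * w"
        using i ii iii N.add_le[of "(s * a + s * a) - a * a" "b * b * (y * y)"]
          N.diff_le[of "s * a + s * a" "a * a"] N.add_le[of "s * a" "s * a"] by simp
      then show False using w by simp
    qed
    then show "gauge s = w" using le[of s] w by simp
  qed
qed

text \<open>Along a chain the pointwise infimum is again a seminorm, since any two members lie above
  a common one that can be used for both arguments. The values on \<open>T\<close> are constant
  along the chain and survive.\<close>

lemma minimal_seminorm:
  fixes N\<^sub>0 :: "'a::comm_ring_1 \<Rightarrow> real"
  assumes "ring_seminorm N\<^sub>0" and "\<And>s w. (s, w) \<in> T \<Longrightarrow> N\<^sub>0 s = w"
  obtains N where "ring_seminorm N" "\<And>x. N x \<le> N\<^sub>0 x" "\<And>s w. (s, w) \<in> T \<Longrightarrow> N s = w"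
    "\<And>L. ring_seminorm L \<Longrightarrow> (\<And>x. L x \<le> N x) \<Longrightarrow> (\<And>s w. (s, w) \<in> T \<Longrightarrow> L s = w) \<Longrightarrow> L = N"
proof -
  define A where "A = {N. ring_seminorm N \<and> (\<forall>x. N x \<le> N\<^sub>0 x) \<and> (\<forall>(s, w)\<in>T. N s = w)}"
  \<comment> \<open>The order is reversed, so that the maximal element from Zorn's lemma is a
    minimal seminorm.\<close>
  define P where "P = (\<lambda>N L :: 'a \<Rightarrow> real. \<forall>x. L x \<le> N x)"
  have A0: "N\<^sub>0 \<in> A" using assms by (auto simp: A_def)
  have "\<exists>m\<in>A. \<forall>a\<in>A. P m a \<longrightarrow> a = m"
  proof (rule predicate_Zorn)
    show "partial_order_on A (relation_of P A)"
      unfolding partial_order_on_def preorder_on_def refl_on_def trans_def antisym_def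
        relation_of_def P_def by (auto intro: order_trans intro!: ext antisym)
    fix C assume C: "C \<in> Chains (relation_of P A)"
    have CA: "C \<subseteq> A" using C by (rule Chains_relation_of)
    have chain: "N \<in> C \<Longrightarrow> L \<in> C \<Longrightarrow> P N L \<or> P L N" for N L
      using C unfolding Chains_def relation_of_def by auto
    show "\<exists>u\<in>A. \<forall>a\<in>C. P a u"
    proof (cases "C = {}")
      case False
      define U where "U x c \<longleftrightarrow> (\<exists>N\<in>C. N x \<le> c)" for x c
      have sn: "N \<in> C \<Longrightarrow> ring_seminorm N" for N using CA by (auto simp: A_def)
      interpret gauge_rel U
      proof
        fix x c assume "U x c"
        then show "0 \<le> c" unfolding U_def using sn ring_seminorm.nonneg order_trans by blast
      next
        fix x show "\<exists>c. U x c" using False unfolding U_def by blast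
      next
        show "U 0 0" using False sn ring_seminorm.zero unfolding U_def by fastforce
      next
        fix x c y d assume "U x c" "U y d"
        then obtain N L where NL: "N \<in> C" "N x \<le> c" "L \<in> C" "L y \<le> d" unfolding U_def by blast
        then obtain M where M: "M \<in> C" "M x \<le> c" "M y \<le> d"
          using chain[of N L] unfolding P_def by (meson order_trans)
        interpret M: ring_seminorm M using sn M by blast
        have "M (x - y) \<le> max c d" using M.diff_le[of x y] M by linarith
        then show "U (x - y) (max c d)" using M unfolding U_def by blast
        have "M x * M y \<le> c * d" using M by (intro mult_mono) (auto intro: order_trans[OF M.nonneg])
        then have "M (x * y) \<le> c * d" using M.mult_le[of x y] by linarith
        then show "U (x * y) (c * d)" using M unfolding U_def by blast
      qed
      have le: "gauge x \<le> N x" if "N \<in> C" for x N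
        using that by (intro gauge_le) (auto simp: U_def)
      obtain N where N: "N \<in> C" using False by blast
      have "gauge x \<le> N\<^sub>0 x" for x using order_trans[OF le[OF N]] N CA by (auto simp: A_def)
      moreover have "gauge s = w" if "(s, w) \<in> T" for s w
      proof (rule antisym)
        have *: "L s = w" if "L \<in> C" for L using CA that \<open>(s, w) \<in> T\<close> by (auto simp: A_def)
        show "gauge s \<le> w" using le[OF N, of s] *[OF N] by simp
        show "w \<le> gauge s" using * by (intro gauge_ge) (auto simp: U_def)
      qed
      ultimately have "gauge \<in> A" using ring_seminorm_axioms by (auto simp: A_def)
      then show ?thesis using le unfolding P_def by blast
    qed (use A0 in blast)
  qed
  then obtain N where N: "N \<in> A" and min: "\<And>L. L \<in> A \<Longrightarrow> P N L \<Longrightarrow> L = N" by blast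
  show thesis
  proof
    show "ring_seminorm N" and le: "N x \<le> N\<^sub>0 x" and "(s, w) \<in> T \<Longrightarrow> N s = w" for x s w
      using N by (auto simp: A_def)
    fix L assume L: "ring_seminorm L" "\<And>x. L x \<le> N x" "\<And>s w. (s, w) \<in> T \<Longrightarrow> L s = w"
    have "L x \<le> N\<^sub>0 x" for x using L(2)[of x] le[of x] by (rule order_trans)
    then have "L \<in> A" using L by (auto simp: A_def)
    then show "L = N" using L(2) by (intro min) (auto simp: P_def)
  qed
qed

text \<open>Localizing a minimal \<open>N\<close> at \<open>T\<close> keeps the values on
  \<open>T\<close>, which is closed under products, so it gives back \<open>N\<close>; hence
  elements of \<open>T\<close> are multiplicative for \<open>N\<close>. Adjusting squares likewise
  shows that \<open>N\<close> respects squares, and then all powers. Consequently any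
  \<open>y\<close> with \<open>N y > 0\<close> can be inverted without changing \<open>N\<close>,
  which is multiplicativity.\<close>

proposition multiplicative_seminorm_below:
  fixes N\<^sub>0 :: "'a::comm_ring_1 \<Rightarrow> real"
  assumes "ring_seminorm N\<^sub>0" and T: "weighted_monoid T" and "\<And>s w. (s, w) \<in> T \<Longrightarrow> N\<^sub>0 s = w"
  obtains N where "mult_seminorm N" "\<And>x. N x \<le> N\<^sub>0 x" "\<And>s w. (s, w) \<in> T \<Longrightarrow> N s = w"
proof -
  obtain N where N: "ring_seminorm N" "\<And>x. N x \<le> N\<^sub>0 x"
    and NT: "\<And>s w. (s, w) \<in> T \<Longrightarrow> N s = w"
    and min: "\<And>L. ring_seminorm L \<Longrightarrow> (\<And>x. L x \<le> N x) \<Longrightarrow> (\<And>s w. (s, w) \<in> T \<Longrightarrow> L s = w) \<Longrightarrow> L = N"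
    using minimal_seminorm[of N\<^sub>0 T] assms by blast
  interpret ring_seminorm N by fact
  have one: "N 1 = 1" using NT weighted_monoidD(1)[OF T] by blast
  have homogeneous: "N (s * x) = w * N x" if sw: "(s, w) \<in> T" for s w x
  proof -
    obtain L where L: "ring_seminorm L" "\<And>x. L x \<le> N x"
      "\<And>x s w. (s, w) \<in> T \<Longrightarrow> L x \<le> N (s * x) / w"
      "\<And>x b. (\<And>s w. (s, w) \<in> T \<Longrightarrow> b \<le> N (s * x) / w) \<Longrightarrow> b \<le> L x"
      using localized_seminorm[of N T] N(1) T NT by (metis order_refl)
    have "L s = w" if "(s, w) \<in> T" for s w
    proof (rule antisym)
      show "L s \<le> w" using L(2)[of s] NT[OF that] by simp
      show "w \<le> L s"
      proof (rule L(4))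
        fix t u assume "(t, u) \<in> T"
        then have "N (t * s) = u * w" "0 < u" using weighted_monoidD[OF T] that NT by blast+
        then show "w \<le> N (t * s) / u" by simp
      qed
    qed
    then have "L = N" using min L by blast
    then have "N x \<le> N (s * x) / w" using L(3)[OF sw] by metis
    then have "w * N x \<le> N (s * x)" using weighted_monoidD(2)[OF T sw] by (simp add: field_simps)
    moreover have "N (s * x) \<le> w * N x" using mult_le[of s x] NT[OF sw] by simp
    ultimately show ?thesis by simp
  qed
  have square: "N (y * y) = (N y)\<^sup>2" for y
  proof -
    obtain L where L: "ring_seminorm L" "\<And>x. L x \<le> N x" "\<And>s w. (s, w) \<in> T \<Longrightarrow> L s = w"
      "(L y)\<^sup>2 \<le> N (y * y)" using square_adjusted_seminorm[of N T y] N(1) T NT by metis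
    then have "L = N" using min by blast
    then show ?thesis using L(4) mult_le[of y y] by (simp add: power2_eq_square)
  qed
  have power2: "N (y ^ 2 ^ n) = N y ^ 2 ^ n" for y n
  proof (induction n)
    case (Suc n)
    have "y ^ 2 ^ Suc n = y ^ 2 ^ n * y ^ 2 ^ n" by (simp add: power_add[symmetric] mult_2)
    then show ?case using Suc square[of "y ^ 2 ^ n"] by (simp add: power_mult[symmetric] mult.commute)
  qed simp
  have power_le: "N (y ^ n) \<le> N y ^ n" for y n
  proof (induction n)
    case (Suc n)
    have "N (y ^ Suc n) \<le> N y * N (y ^ n)" using mult_le[of y "y ^ n"] by simp
    also have "\<dots> \<le> N y * N y ^ n" by (intro mult_left_mono Suc) simp
    finally show ?case by simp
  qed (simp add: one)
  \<comment> \<open>If \<open>N y\<close> is positive, \<open>y ^ n\<close> is completed to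
    \<open>y ^ 2 ^ n\<close>, whose norm is known. The complementary factor has at most the expected
    norm, and cancelling it leaves the lower bound.\<close>
  have power: "N (y ^ n) = N y ^ n" for y n
  proof (cases "N y = 0")
    case True
    then show ?thesis using power_le[of y n] one by (cases n) (auto intro: antisym)
  next
    case False
    then have pos: "0 < N y" using nonneg[of y] by linarith
    have n: "n \<le> 2 ^ n" by (simp add: less_imp_le)
    have "N y ^ n * N y ^ (2 ^ n - n) = N (y ^ n * y ^ (2 ^ n - n))"
      using n by (simp add: power_add[symmetric] power2)
    also have "\<dots> \<le> N (y ^ n) * N y ^ (2 ^ n - n)"
      by (intro order_trans[OF mult_le] mult_left_mono power_le) simp
    finally have "N y ^ n \<le> N (y ^ n)" using pos by simp
    then show ?thesis using power_le[of y n] by simp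
  qed
  have mult: "N (y * x) = N y * N x" for x y
  proof (cases "N y = 0")
    case True
    then show ?thesis using mult_le[of y x] nonneg[of "y * x"] by simp
  next
    case False
    then have pos: "0 < N y" using nonneg[of y] by linarith
    \<comment> \<open>Localizing at the powers of \<open>y\<close> keeps the value \<open>w\<close>
      of \<open>s\<close> because \<open>homogeneous\<close> evaluates \<open>N (t * s)\<close> even
      for \<open>t\<close> outside \<open>T\<close>.\<close>
    define S where "S = range (\<lambda>n. (y ^ n, N y ^ n))"
    have S: "weighted_monoid S"
      unfolding weighted_monoid_def S_def using pos
      by (auto simp: power_add[symmetric] intro: image_eqI[of _ _ 0])
    have SN: "N s \<le> w" if "(s, w) \<in> S" for s w using that power by (auto simp: S_def)
    obtain L where L: "ring_seminorm L" "\<And>x. L x \<le> N x"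
      "\<And>x s w. (s, w) \<in> S \<Longrightarrow> L x \<le> N (s * x) / w"
      "\<And>x b. (\<And>s w. (s, w) \<in> S \<Longrightarrow> b \<le> N (s * x) / w) \<Longrightarrow> b \<le> L x"
      using localized_seminorm[OF N(1) S SN] by metis
    have "L s = w" if sw: "(s, w) \<in> T" for s w
    proof (rule antisym)
      show "L s \<le> w" using L(2)[of s] NT[OF that] by simp
      show "w \<le> L s"
      proof (rule L(4))
        fix t u assume "(t, u) \<in> S"
        then have "N t = u" "0 < u" using power pos by (auto simp: S_def)
        moreover have "N (t * s) = w * N t" using homogeneous[OF sw, of t] by (simp add: mult.commute)
        ultimately show "w \<le> N (t * s) / u" by simp
      qed
    qed
    then have "L = N" using min L by blast
    moreover have "(y, N y) \<in> S" unfolding S_def by (rule image_eqI[of _ _ 1]) auto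
    ultimately have "N x \<le> N (y * x) / N y" using L(3) by metis
    then have "N y * N x \<le> N (y * x)" using pos by (simp add: field_simps)
    then show ?thesis using mult_le[of y x] by simp
  qed
  show thesis
  proof
    show "mult_seminorm N" using one mult by unfold_locales
  qed (fact N(2) NT)+
qed

subsection \<open>Linear functionals\<close>

text \<open>Additive extension from single terms. Renaming of variables, linear functionals and
  evaluation of integral polynomials are all instances, and share the lemmas that only ask each
  \<open>G m\<close> to be additive.\<close>

definition pm_sum :: "('m \<Rightarrow> 'a::zero \<Rightarrow> 'd::comm_monoid_add) \<Rightarrow> ('m \<Rightarrow>\<^sub>0 'a) \<Rightarrow> 'd" where
  "pm_sum G z = (\<Sum>m\<in>Poly_Mapping.keys z. G m (Poly_Mapping.lookup z m))"

lemma pm_sum_superset: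
  assumes "finite F" "Poly_Mapping.keys z \<subseteq> F" "\<And>m. G m 0 = 0"
  shows "pm_sum G z = (\<Sum>m\<in>F. G m (Poly_Mapping.lookup z m))"
  unfolding pm_sum_def using assms
  by (intro sum.mono_neutral_left) (auto simp: in_keys_iff)

lemma pm_sum_single:
  assumes "\<And>m. G m 0 = 0"
  shows "pm_sum G (Poly_Mapping.single m a) = G m a"
  using assms by (simp add: pm_sum_def)

lemma pm_sum_zero [simp]: "pm_sum G 0 = 0"
  by (simp add: pm_sum_def)

lemma pm_sum_add:
  assumes "\<And>m. G m 0 = 0" "\<And>m a b. G m (a + b) = G m a + G m b"
  shows "pm_sum G (y + z) = pm_sum G y + pm_sum G z"
proof -
  let ?F = "Poly_Mapping.keys y \<union> Poly_Mapping.keys z"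
  have "finite ?F" "Poly_Mapping.keys (y + z) \<subseteq> ?F" by (simp_all add: Poly_Mapping.keys_add)
  then show ?thesis
    using assms by (simp add: pm_sum_superset[of ?F] lookup_add sum.distrib)
qed

lemma pm_sum_diff:
  fixes G :: "'m \<Rightarrow> 'a::ab_group_add \<Rightarrow> 'd::ab_group_add"
  assumes "\<And>m. G m 0 = 0" "\<And>m a b. G m (a + b) = G m a + G m b"
  shows "pm_sum G (y - z) = pm_sum G y - pm_sum G z"
  using pm_sum_add[of G "y - z" z] assms by simp

lemma pm_sum_sum:
  assumes "\<And>m. G m 0 = 0" "\<And>m a b. G m (a + b) = G m a + G m b"
  shows "pm_sum G (\<Sum>i\<in>I. z i) = (\<Sum>i\<in>I. pm_sum G (z i))"
  by (induction I rule: infinite_finite_induct) (simp_all add: pm_sum_add assms)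

lemma pm_expand: "z = (\<Sum>m\<in>Poly_Mapping.keys z. Poly_Mapping.single m (Poly_Mapping.lookup z m))"
  by (rule poly_mapping_eqI)
    (auto simp: lookup_sum lookup_single when_def sum.delta in_keys_iff)

lemma pm_sum_mult:
  fixes G :: "'m::comm_monoid_add \<Rightarrow> 'a::comm_semiring_0 \<Rightarrow> 'd::comm_semiring_0"
  assumes G: "\<And>m. G m 0 = 0" "\<And>m a b. G m (a + b) = G m a + G m b"
    and mult: "\<And>m m' a b. G (m + m') (a * b) = G m a * G m' b"
  shows "pm_sum G (y * z) = pm_sum G y * pm_sum G z"
proof -
  have "y * z = (\<Sum>m\<in>Poly_Mapping.keys y. \<Sum>m'\<in>Poly_Mapping.keys z.
    Poly_Mapping.single (m + m') (Poly_Mapping.lookup y m * Poly_Mapping.lookup z m'))"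
    by (subst pm_expand[of y], subst pm_expand[of z]) (simp add: sum_product mult_single)
  then show ?thesis
    by (simp add: pm_sum_sum pm_sum_single G mult sum_product) (simp add: pm_sum_def sum_product)
qed

lemma prod_single:
  "(\<Prod>i\<in>I. Poly_Mapping.single (m i) (a i :: 'a::comm_semiring_1))
    = Poly_Mapping.single (\<Sum>i\<in>I. m i) (\<Prod>i\<in>I. a i)"
  by (induction I rule: infinite_finite_induct) (simp_all add: mult_single)

text \<open>
  A finite form of the Hahn-Banach theorem, without denominators: \<open>u\<close> is the coordinate vector of a
  linear functional. The induction step eliminates the coordinate \<open>j\<close> by projecting along the
  vector \<open>\<beta>\<close> of smallest norm relative to its \<open>j\<close>-th coordinate.
\<close>

lemma finite_hahn_banach:
  fixes h :: "'a::comm_ring_1 \<Rightarrow> 'b::comm_ring_1" and b :: "'i \<Rightarrow> 'b"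
  assumes "mult_seminorm n\<^sub>0" and "ring_seminorm n"
    and homogeneous: "\<And>a x. n (h a * x) = n\<^sub>0 a * n x"
    and h_diff: "\<And>a c. h (a - c) = h a - h c"
    and h_mult: "\<And>a c. h (a * c) = h a * h c"
    and "finite F" "i\<^sub>0 \<notin> F" "finite Z"
  shows "\<exists>u. n\<^sub>0 (u i\<^sub>0) \<noteq> 0 \<and> (\<forall>z\<in>Z. n\<^sub>0 (\<Sum>i\<in>insert i\<^sub>0 F. z i * u i) * n (b i\<^sub>0)
    \<le> n\<^sub>0 (u i\<^sub>0) * n (\<Sum>i\<in>insert i\<^sub>0 F. h (z i) * b i))"
  using \<open>finite F\<close> \<open>i\<^sub>0 \<notin> F\<close> \<open>finite Z\<close>
proof (induction F arbitrary: Z rule: finite_induct)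
  case empty
  interpret n0: mult_seminorm n\<^sub>0 by fact
  show ?case by (rule exI[of _ "\<lambda>_. 1"]) (simp add: homogeneous)
next
  case (insert j F)
  interpret n0: mult_seminorm n\<^sub>0 by fact
  interpret n: ring_seminorm n by fact
  define G where "G = insert i\<^sub>0 F"
  define \<rho> where "\<rho> z = n (\<Sum>i\<in>insert j G. h (z i) * b i)" for z
  have G: "finite G" "j \<notin> G" "i\<^sub>0 \<in> G" "insert i\<^sub>0 (insert j F) = insert j G"
    using insert by (auto simp: G_def)
  have IH: "\<exists>u. n\<^sub>0 (u i\<^sub>0) \<noteq> 0 \<and> (\<forall>z\<in>Z. n\<^sub>0 (\<Sum>i\<in>G. z i * u i) * n (b i\<^sub>0)
    \<le> n\<^sub>0 (u i\<^sub>0) * n (\<Sum>i\<in>G. h (z i) * b i))" if "finite Z" for Z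
    using insert that by (simp add: G_def)
  have "\<exists>u. n\<^sub>0 (u i\<^sub>0) \<noteq> 0 \<and> (\<forall>z\<in>Z. n\<^sub>0 (\<Sum>i\<in>insert j G. z i * u i) * n (b i\<^sub>0) \<le> n\<^sub>0 (u i\<^sub>0) * \<rho> z)"
  proof (cases "\<forall>z\<in>Z. n\<^sub>0 (z j) = 0")
    \<comment> \<open>When \<open>z j\<close> is null, dropping the summand at \<open>j\<close> does
      not increase the seminorm, so the functional on \<open>G\<close> can be extended by 0.\<close>
    case True
    obtain u where u: "n\<^sub>0 (u i\<^sub>0) \<noteq> 0" "\<And>z. z \<in> Z \<Longrightarrow> n\<^sub>0 (\<Sum>i\<in>G. z i * u i) * n (b i\<^sub>0)
      \<le> n\<^sub>0 (u i\<^sub>0) * n (\<Sum>i\<in>G. h (z i) * b i)" using IH[OF insert.prems(2)] by blast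
    have "n\<^sub>0 (\<Sum>i\<in>insert j G. z i * (u(j := 0)) i) * n (b i\<^sub>0) \<le> n\<^sub>0 (u i\<^sub>0) * \<rho> z" if z: "z \<in> Z" for z
    proof -
      have "(\<Sum>i\<in>insert j G. z i * (u(j := 0)) i) = (\<Sum>i\<in>G. z i * u i)"
        using G by (auto intro!: sum.cong)
      moreover have "n (\<Sum>i\<in>G. h (z i) * b i) \<le> \<rho> z"
        using n.diff_le[of "\<Sum>i\<in>insert j G. h (z i) * b i" "h (z j) * b j"] G True z
        by (simp add: \<rho>_def homogeneous)
      ultimately show ?thesis using u(2)[OF z] mult_left_mono[of _ "\<rho> z" "n\<^sub>0 (u i\<^sub>0)"] by force
    qed
    moreover have "(u(j := 0)) i\<^sub>0 = u i\<^sub>0" using G by auto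
    ultimately show ?thesis using u(1) by (intro exI[of _ "u(j := 0)"]) simp
  next
    case False
    define Y where "Y = {z\<in>Z. n\<^sub>0 (z j) \<noteq> 0}"
    have Y: "finite Y" "Y \<noteq> {}" using False insert.prems by (auto simp: Y_def)
    define \<beta> where "\<beta> = arg_min_on (\<lambda>z. \<rho> z / n\<^sub>0 (z j)) Y"
    have "\<beta> \<in> Y" and min: "\<And>z. z \<in> Y \<Longrightarrow> \<rho> \<beta> / n\<^sub>0 (\<beta> j) \<le> \<rho> z / n\<^sub>0 (z j)"
      using arg_min_if_finite[OF Y, of "\<lambda>z. \<rho> z / n\<^sub>0 (z j)"] unfolding \<beta>_def by (auto simp: not_less)
    then have \<beta>: "0 < n\<^sub>0 (\<beta> j)" using n0.nonneg[of "\<beta> j"] by (simp add: Y_def less_le)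
    \<comment> \<open>Multiplying out the minimality of \<open>\<beta>\<close> makes it hold also
      for the vectors whose \<open>j\<close>-th coordinate is null.\<close>
    have min': "n\<^sub>0 (z j) * \<rho> \<beta> \<le> n\<^sub>0 (\<beta> j) * \<rho> z" if "z \<in> Z" for z
    proof (cases "n\<^sub>0 (z j) = 0")
      case True
      then show ?thesis using \<beta> by (simp add: \<rho>_def)
    next
      case False
      then have "0 < n\<^sub>0 (z j)" using n0.nonneg[of "z j"] by (simp add: less_le)
      then show ?thesis using min[of z] False that \<beta> by (simp add: Y_def field_simps)
    qed
    define p where "p z i = \<beta> j * z i - z j * \<beta> i" for z i
    obtain u where u: "n\<^sub>0 (u i\<^sub>0) \<noteq> 0" "\<And>z. z \<in> Z \<Longrightarrow> n\<^sub>0 (\<Sum>i\<in>G. p z i * u i) * n (b i\<^sub>0)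
      \<le> n\<^sub>0 (u i\<^sub>0) * n (\<Sum>i\<in>G. h (p z i) * b i)" using IH[of "p ` Z"] insert.prems(2) by blast
    \<comment> \<open>The coordinate at \<open>j\<close> is chosen so that the new functional
      vanishes on \<open>\<beta>\<close>. The factor \<open>\<beta> j\<close> clears the denominator
      of the projection, and the value at \<open>z\<close> is that of \<open>u\<close> at
      \<open>p z\<close>.\<close>
    define u' where "u' i = (if i = j then - (\<Sum>i\<in>G. \<beta> i * u i) else \<beta> j * u i)" for i
    have u'_G: "(\<Sum>i\<in>G. z i * u' i) = (\<Sum>i\<in>G. z i * (\<beta> j * u i))" for z
      using G by (auto intro!: sum.cong simp: u'_def)
    have u'_0: "n\<^sub>0 (u' i\<^sub>0) = n\<^sub>0 (\<beta> j) * n\<^sub>0 (u i\<^sub>0)" using G by (auto simp: u'_def n0.mult)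
    have "n\<^sub>0 (\<Sum>i\<in>insert j G. z i * u' i) * n (b i\<^sub>0) \<le> n\<^sub>0 (u' i\<^sub>0) * \<rho> z" if z: "z \<in> Z" for z
    proof -
      have "(\<Sum>i\<in>insert j G. z i * u' i) = (\<Sum>i\<in>G. p z i * u i)"
        using G u'_G[of z]
        by (simp add: u'_def[of j] p_def left_diff_distrib right_diff_distrib
            sum_subtractf sum_distrib_left mult_ac)
      moreover have "n (\<Sum>i\<in>G. h (p z i) * b i) \<le> n\<^sub>0 (\<beta> j) * \<rho> z"
      proof -
        have "(\<Sum>i\<in>G. h (p z i) * b i) =
          h (\<beta> j) * (\<Sum>i\<in>insert j G. h (z i) * b i) - h (z j) * (\<Sum>i\<in>insert j G. h (\<beta> i) * b i)"
          using G by (simp add: p_def h_diff h_mult left_diff_distrib right_diff_distrib sum_subtractf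
            sum_distrib_left distrib_left mult_ac)
        then have "n (\<Sum>i\<in>G. h (p z i) * b i) \<le> max (n\<^sub>0 (\<beta> j) * \<rho> z) (n\<^sub>0 (z j) * \<rho> \<beta>)"
          using n.diff_le by (simp only: \<rho>_def homogeneous[symmetric])
        then show ?thesis using min'[OF z] by linarith
      qed
      ultimately show ?thesis
        using u(2)[OF z] mult_left_mono[of _ "n\<^sub>0 (\<beta> j) * \<rho> z" "n\<^sub>0 (u i\<^sub>0)"] by (fastforce simp: u'_0 mult_ac)
    qed
    moreover have "n\<^sub>0 (u' i\<^sub>0) \<noteq> 0" using u(1) \<beta> by (simp add: u'_0)
    ultimately show ?thesis by blast
  qed
  then show ?case by (simp only: G \<rho>_def)
qed

text \<open>
  The vector \<open>s\<close> is adjoined to the basis as an additional generator \<open>None\<close>; the seminorm of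
  \<open>None - s\<close> is then \<open>0\<close>, so that the functional takes the same value on both up to norm \<open>0\<close>.
\<close>

corollary finite_hahn_banach_free:
  fixes n :: "('m::comm_monoid_add \<Rightarrow>\<^sub>0 'a::comm_ring_1) \<Rightarrow> real"
  assumes "mult_seminorm n\<^sub>0" and "mult_seminorm n"
    and const: "\<And>a. n (Poly_Mapping.single 0 a) = n\<^sub>0 a"
    and "finite Z" and s: "n s \<noteq> 0"
  obtains u where "n\<^sub>0 (pm_sum (\<lambda>m a. a * u m) s) \<noteq> 0"
    "\<And>z. z \<in> Z \<Longrightarrow> n\<^sub>0 (pm_sum (\<lambda>m a. a * u m) z) * n s \<le> n\<^sub>0 (pm_sum (\<lambda>m a. a * u m) s) * n z"
proof -
  interpret n0: mult_seminorm n\<^sub>0 by fact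
  interpret n: mult_seminorm n by fact
  define F where "F = \<Union> (Poly_Mapping.keys ` insert s Z)"
  have F: "finite F" using assms by (auto simp: F_def)
  define b where "b = case_option s (\<lambda>m. Poly_Mapping.single m (1::'a))"
  define vec where "vec a z = case_option a (Poly_Mapping.lookup z)" for a and z :: "'m \<Rightarrow>\<^sub>0 'a"
  have phi: "(\<Sum>i\<in>insert None (Some ` F). vec a z i * u i)
    = a * u None + pm_sum (\<lambda>m a. a * u (Some m)) z" if "z \<in> insert s (insert (- s) Z)" for a z u
  proof -
    have "Poly_Mapping.keys z \<subseteq> F" using that by (auto simp: F_def in_keys_iff)
    then show ?thesis using F by (simp add: vec_def sum.reindex pm_sum_superset[of F])
  qed
  have val: "(\<Sum>i\<in>insert None (Some ` F). Poly_Mapping.single 0 (vec a z i) * b i)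
    = Poly_Mapping.single 0 a * s + z" if "z \<in> insert s (insert (- s) Z)" for a z
  proof -
    have "Poly_Mapping.keys z \<subseteq> F" using that by (auto simp: F_def in_keys_iff)
    then have "z = (\<Sum>m\<in>F. Poly_Mapping.single m (Poly_Mapping.lookup z m))"
      by (subst pm_expand) (use F in \<open>auto intro!: sum.mono_neutral_left simp: in_keys_iff\<close>)
    then show ?thesis using F by (simp add: vec_def b_def sum.reindex mult_single)
  qed
  obtain u where u: "n\<^sub>0 (u None) \<noteq> 0"
    and le: "\<And>z. z \<in> insert (vec 1 (- s)) (vec 0 ` Z) \<Longrightarrow>
      n\<^sub>0 (\<Sum>i\<in>insert None (Some ` F). z i * u i) * n (b None)
      \<le> n\<^sub>0 (u None) * n (\<Sum>i\<in>insert None (Some ` F). Poly_Mapping.single 0 (z i) * b i)"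
    using finite_hahn_banach[of n\<^sub>0 n "Poly_Mapping.single 0" "Some ` F" None
        "insert (vec 1 (- s)) (vec 0 ` Z)" b]
      assms(1,2,4) F n.ring_seminorm_axioms
    by (auto simp: n.mult const single_diff mult_single)
  have b_None: "b None = s" by (simp add: b_def)
  let ?phi = "pm_sum (\<lambda>m a. a * u (Some m))"
  have phi_minus: "?phi (- s) = - ?phi s"
    using pm_sum_diff[of "\<lambda>m a. a * u (Some m)" 0 s] by (simp add: distrib_right)
  have "n\<^sub>0 (u None - ?phi s) * n s \<le> 0"
    using le[of "vec 1 (- s)"] by (simp add: phi val phi_minus b_None del: sum.insert)
  then have "n\<^sub>0 (u None - ?phi s) = 0"
    using s n.nonneg[of s] n0.nonneg[of "u None - ?phi s"] by (simp add: mult_le_0_iff)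
  then have eq: "n\<^sub>0 (?phi s) = n\<^sub>0 (u None)" using n0.eq_of_diff_zero by metis
  show thesis
  proof
    show "n\<^sub>0 (?phi s) \<noteq> 0" using u eq by simp
    show "n\<^sub>0 (?phi z) * n s \<le> n\<^sub>0 (?phi s) * n z" if "z \<in> Z" for z
      using le[of "vec 0 z"] that by (simp add: phi val eq b_None del: sum.insert)
  qed
qed

subsection \<open>Amalgamation\<close>

definition index_monom :: "'c \<Rightarrow> ('b \<Rightarrow>\<^sub>0 nat) \<Rightarrow> ('c \<times> 'b \<Rightarrow>\<^sub>0 nat)" where
  "index_monom c m = pm_sum (\<lambda>b k. Poly_Mapping.single (c, b) k) m"

definition part_monom :: "'c \<Rightarrow> ('c \<times> 'b \<Rightarrow>\<^sub>0 nat) \<Rightarrow> ('b \<Rightarrow>\<^sub>0 nat)" where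
  "part_monom c m = Poly_Mapping.map_key (Pair c) m"

text \<open>The canonical map of the \<open>c\<close>-th factor into the tensor product.
  Coefficients are left alone, so all factors share the constants from \<open>A\<close>.\<close>

definition index_poly ::
  "'c \<Rightarrow> (('b \<Rightarrow>\<^sub>0 nat) \<Rightarrow>\<^sub>0 'a::comm_ring_1) \<Rightarrow> (('c \<times> 'b \<Rightarrow>\<^sub>0 nat) \<Rightarrow>\<^sub>0 'a)" where
  "index_poly c z = pm_sum (\<lambda>m a. Poly_Mapping.single (index_monom c m) a) z"

lemma index_monom_add: "index_monom c (m + m') = index_monom c m + index_monom c m'"
  unfolding index_monom_def by (rule pm_sum_add) (simp_all add: single_add)

lemma index_monom_single: "index_monom c (Poly_Mapping.single b k) = Poly_Mapping.single (c, b) k"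
  unfolding index_monom_def by (subst pm_sum_single) simp_all

lemma index_monom_zero [simp]: "index_monom c 0 = 0"
  by (simp add: index_monom_def)

lemma part_monom_add: "part_monom c (m + m') = part_monom c m + part_monom c m'"
  unfolding part_monom_def by (rule map_key_plus) (simp add: inj_def)

lemma part_monom_zero [simp]: "part_monom c 0 = 0"
  unfolding part_monom_def by (rule map_key_zero) (simp add: inj_def)

lemma part_monom_sum: "part_monom c (\<Sum>i\<in>I. m i) = (\<Sum>i\<in>I. part_monom c (m i))"
  by (induction I rule: infinite_finite_induct) (simp_all add: part_monom_add)

text \<open>Variables of different copies are disjoint. A product of monomials, one from each copy,
  can therefore be taken apart again, which is what makes a product of functionals well defined on
  it.\<close>

lemma part_index_monom:
  fixes m :: "'b \<Rightarrow>\<^sub>0 nat"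
  shows "part_monom c (index_monom d m) = (if c = d then m else 0)"
proof -
  have "Poly_Mapping.lookup (part_monom c (index_monom d m)) b = Poly_Mapping.lookup (if c = d then m else 0) b" for b
  proof -
    have "inj (Pair c :: 'b \<Rightarrow> _)" by (simp add: inj_def)
    then have "Poly_Mapping.lookup (part_monom c (index_monom d m)) b
      = Poly_Mapping.lookup (index_monom d m) (c, b)" by (simp add: part_monom_def map_key.rep_eq[OF \<open>inj (Pair c)\<close>])
    also have "\<dots> = Poly_Mapping.lookup (if c = d then m else 0) b"
      by (auto simp: index_monom_def pm_sum_def lookup_sum lookup_single when_def sum.delta in_keys_iff)
    finally show ?thesis .
  qed
  then show ?thesis by (rule poly_mapping_eqI)
qed

lemma index_poly_diff: "index_poly c (y - z) = index_poly c y - index_poly c z"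
  unfolding index_poly_def by (rule pm_sum_diff) (simp_all add: single_add)

lemma index_poly_mult: "index_poly c (y * z) = index_poly c y * index_poly c z"
  unfolding index_poly_def
  by (rule pm_sum_mult) (simp_all add: single_add index_monom_add mult_single)

lemma index_poly_single:
  "index_poly c (Poly_Mapping.single m a) = Poly_Mapping.single (index_monom c m) a"
  unfolding index_poly_def by (subst pm_sum_single) simp_all

lemma index_poly_one [simp]: "index_poly c 1 = 1"
  using index_poly_single[of c 0 1] by simp

text \<open>A product of functionals on the factors is a functional on the tensor product.\<close>

lemma pm_sum_prod_index_poly:
  fixes u :: "'c \<Rightarrow> ('b \<Rightarrow>\<^sub>0 nat) \<Rightarrow> 'a::comm_ring_1"
  assumes W: "finite W"
  shows "pm_sum (\<lambda>m a. a * (\<Prod>c\<in>W. u c (part_monom c m)))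
      (Poly_Mapping.single 0 a * (\<Prod>c\<in>W. index_poly c (z c)))
    = a * (\<Prod>c\<in>W. pm_sum (\<lambda>m a. a * u c m) (z c))"
proof -
  let ?G = "\<lambda>m a. a * (\<Prod>c\<in>W. u c (part_monom c m))"
  let ?X = "PiE W (\<lambda>c. Poly_Mapping.keys (z c))"
  let ?m = "\<lambda>g. \<Sum>c\<in>W. index_monom c (g c)"
  have part: "part_monom c (?m g) = g c" if "c \<in> W" for c g
    using W that by (simp add: part_monom_sum part_index_monom sum.delta)
  \<comment> \<open>Multiplying out gives one term for each choice \<open>g\<close> of a monomial in
    every factor; \<open>part\<close> recovers \<open>g\<close>, and the same expansion read
    backwards yields the product of the functionals.\<close>
  have "Poly_Mapping.single 0 a * (\<Prod>c\<in>W. index_poly c (z c))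
    = (\<Sum>g\<in>?X. Poly_Mapping.single (?m g) (a * (\<Prod>c\<in>W. Poly_Mapping.lookup (z c) (g c))))"
    unfolding index_poly_def pm_sum_def
    by (subst prod_sum_PiE[OF W]) (simp_all add: prod_single sum_distrib_left mult_single)
  then have "pm_sum ?G (Poly_Mapping.single 0 a * (\<Prod>c\<in>W. index_poly c (z c)))
    = (\<Sum>g\<in>?X. ?G (?m g) (a * (\<Prod>c\<in>W. Poly_Mapping.lookup (z c) (g c))))"
    by (simp add: pm_sum_sum pm_sum_single distrib_right)
  also have "\<dots> = (\<Sum>g\<in>?X. a * (\<Prod>c\<in>W. Poly_Mapping.lookup (z c) (g c) * u c (g c)))"
    by (simp add: part prod.distrib mult_ac)
  also have "\<dots> = a * (\<Prod>c\<in>W. pm_sum (\<lambda>m a. a * u c m) (z c))"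
    unfolding pm_sum_def by (subst prod_sum_PiE[OF W]) (simp_all add: sum_distrib_left)
  finally show ?thesis .
qed

text \<open>
  \<open>n c\<close> is a seminorm on the \<open>c\<close>-th copy of \<open>A[X]\<close>, and \<open>A[X \<times> C]\<close> is the tensor product
  over \<open>A\<close> of all these copies.
\<close>

locale seminorm_family = n0: mult_seminorm n\<^sub>0
  for n\<^sub>0 :: "'a::comm_ring_1 \<Rightarrow> real" +
  fixes n :: "'c \<Rightarrow> (('b \<Rightarrow>\<^sub>0 nat) \<Rightarrow>\<^sub>0 'a) \<Rightarrow> real"
  assumes n: "mult_seminorm (n c)"
    and n_const: "n c (Poly_Mapping.single 0 a) = n\<^sub>0 a"
begin

text \<open>A relation rather than a function, since an element may be presented as a pure tensor in
  several ways. That all presentations have the same weight follows only from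
  \<open>pure_tensor_le_bound\<close>.\<close>

inductive pure_tensor :: "(('c \<times> 'b \<Rightarrow>\<^sub>0 nat) \<Rightarrow>\<^sub>0 'a) \<Rightarrow> real \<Rightarrow> bool" where
  const: "pure_tensor (Poly_Mapping.single 0 a) (n\<^sub>0 a)"
| step: "pure_tensor x w \<Longrightarrow> pure_tensor (x * index_poly c z) (w * n c z)"

text \<open>The additive group generated by the pure tensors of weight at most \<open>t\<close>. The
  least such \<open>t\<close>, as an infimum, is the projective tensor seminorm in its ultrametric
  form.\<close>

inductive tensor_bound :: "(('c \<times> 'b \<Rightarrow>\<^sub>0 nat) \<Rightarrow>\<^sub>0 'a) \<Rightarrow> real \<Rightarrow> bool" where
  pure: "pure_tensor x w \<Longrightarrow> w \<le> t \<Longrightarrow> tensor_bound x t"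
| diff: "tensor_bound x t \<Longrightarrow> tensor_bound y t \<Longrightarrow> tensor_bound (x - y) t"

lemma n_nonneg: "0 \<le> n c z"
proof -
  interpret mult_seminorm "n c" by (rule n)
  show ?thesis by simp
qed

lemma pure_tensor_nonneg: "pure_tensor x w \<Longrightarrow> 0 \<le> w"
  by (induction rule: pure_tensor.induct) (simp_all add: n_nonneg)

lemma pure_tensor_mult: "pure_tensor y w' \<Longrightarrow> pure_tensor x w \<Longrightarrow> pure_tensor (x * y) (w * w')"
proof (induction rule: pure_tensor.induct)
  case (const a)
  from const show ?case
  proof (induction rule: pure_tensor.induct)
    case (const b)
    then show ?case using pure_tensor.const[of "b * a"] by (simp add: mult_single n0.mult)
  next
    case (step x w c z)
    then show ?case
      using pure_tensor.step[of "x * Poly_Mapping.single 0 a" "w * n\<^sub>0 a" c z] by (simp add: mult_ac)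
  qed
next
  case (step y w' c z)
  then show ?case using pure_tensor.step[of "x * y" "w * w'" c z] by (simp add: mult.assoc)
qed

text \<open>The quantification over all finite \<open>W\<close> above \<open>W\<^sub>0\<close>
  allows finitely many pure tensors to be written over one common set of factors.\<close>

definition decomposes where
  "decomposes x w W\<^sub>0 a z \<longleftrightarrow> finite W\<^sub>0 \<and> (\<forall>W. finite W \<longrightarrow> W\<^sub>0 \<subseteq> W \<longrightarrow>
    x = Poly_Mapping.single 0 a * (\<Prod>c\<in>W. index_poly c (z c)) \<and> w = n\<^sub>0 a * (\<Prod>c\<in>W. n c (z c)))"

lemma pure_tensor_decomposes:
  assumes "pure_tensor x w"
  shows "\<exists>W\<^sub>0 a z. decomposes x w W\<^sub>0 a z"
  using assms unfolding decomposes_def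
proof (induction rule: pure_tensor.induct)
  case (const a)
  have "n c 1 = 1" for c using n mult_seminorm.one by blast
  then show ?case by (intro exI[of _ "{}"] exI[of _ a] exI[of _ "\<lambda>_. 1"]) simp
next
  case (step x w d y)
  then obtain W\<^sub>0 a z where *: "finite W\<^sub>0" "\<And>W. finite W \<Longrightarrow> W\<^sub>0 \<subseteq> W \<Longrightarrow>
    x = Poly_Mapping.single 0 a * (\<Prod>c\<in>W. index_poly c (z c)) \<and> w = n\<^sub>0 a * (\<Prod>c\<in>W. n c (z c))"
    by blast
  let ?z = "z(d := z d * y)"
  have "x * index_poly d y = Poly_Mapping.single 0 a * (\<Prod>c\<in>W. index_poly c (?z c)) \<and>
    w * n d y = n\<^sub>0 a * (\<Prod>c\<in>W. n c (?z c))" if W: "finite W" "insert d W\<^sub>0 \<subseteq> W" for W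
  proof -
    have d: "d \<in> W" using W by blast
    have z: "z c = ?z c" if "c \<in> W - {d}" for c using that by simp
    have "(\<Prod>c\<in>W. index_poly c (?z c)) = (\<Prod>c\<in>W. index_poly c (z c)) * index_poly d y"
      using W(1) d by (simp add: prod.remove[of W d] index_poly_mult mult_ac)
    moreover have "(\<Prod>c\<in>W. n c (?z c)) = (\<Prod>c\<in>W. n c (z c)) * n d y"
      using W(1) d mult_seminorm.mult[OF n, of d "z d" y] by (simp add: prod.remove[of W d] mult_ac)
    ultimately show ?thesis using *(2)[of W] W by (simp add: mult_ac)
  qed
  then show ?case using *(1)
    by (intro exI[of _ "insert d W\<^sub>0"] exI[of _ a] exI[of _ ?z]) blast
qed

text \<open>What remains of a representation of \<open>x\<close> by elements of \<open>Y\<close>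
  once it is only tested with additive maps. The map \<open>\<Phi>\<close> is quantified inside
  because the functional is chosen after \<open>Y\<close>.\<close>

definition dominates :: "((('c \<times> 'b \<Rightarrow>\<^sub>0 nat) \<Rightarrow>\<^sub>0 'a) \<times> real) set \<Rightarrow> (('c \<times> 'b \<Rightarrow>\<^sub>0 nat) \<Rightarrow>\<^sub>0 'a) \<Rightarrow> bool" where
  "dominates Y x \<longleftrightarrow> (\<forall>\<Phi> B. (\<forall>x y. \<Phi> (x - y) = \<Phi> x - \<Phi> y) \<longrightarrow> (\<forall>p\<in>Y. n\<^sub>0 (\<Phi> (fst p)) \<le> B) \<longrightarrow> n\<^sub>0 (\<Phi> x) \<le> B)"

lemma dominates_diff:
  assumes "dominates Y x" "dominates Y' y"
  shows "dominates (Y \<union> Y') (x - y)"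
  unfolding dominates_def
proof (intro allI impI)
  fix \<Phi> :: "_ \<Rightarrow> 'a" and B
  assume *: "\<forall>x y. \<Phi> (x - y) = \<Phi> x - \<Phi> y" "\<forall>p\<in>Y \<union> Y'. n\<^sub>0 (\<Phi> (fst p)) \<le> B"
  have "n\<^sub>0 (\<Phi> x) \<le> B" using assms(1)[unfolded dominates_def, rule_format, of \<Phi> B] * by simp
  moreover have "n\<^sub>0 (\<Phi> y) \<le> B" using assms(2)[unfolded dominates_def, rule_format, of \<Phi> B] * by simp
  ultimately show "n\<^sub>0 (\<Phi> (x - y)) \<le> B" using n0.diff_le[of "\<Phi> x" "\<Phi> y"] *(1) by simp
qed

lemma tensor_bound_witnesses:
  assumes "tensor_bound x t"
  shows "\<exists>Y. finite Y \<and> (\<forall>(y, w)\<in>Y. pure_tensor y w \<and> w \<le> t) \<and> dominates Y x"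
  using assms
proof (induction rule: tensor_bound.induct)
  case (pure x w t)
  then show ?case by (intro exI[of _ "{(x, w)}"]) (simp add: dominates_def)
next
  case (diff x t y)
  obtain Y where Y: "finite Y" "\<forall>(y, w)\<in>Y. pure_tensor y w \<and> w \<le> t" "dominates Y x"
    using diff.IH(1) by blast
  obtain Y' where Y': "finite Y'" "\<forall>(y, w)\<in>Y'. pure_tensor y w \<and> w \<le> t" "dominates Y' y"
    using diff.IH(2) by blast
  show ?case using Y Y' dominates_diff[OF Y(3) Y'(3)] by (intro exI[of _ "Y \<union> Y'"]) auto
qed

text \<open>This is the lower bound for the projective seminorm. In each factor a functional is
  chosen that attains the norm on the component of \<open>s\<close>, relative to the components of
  the finitely many tensors in \<open>Y\<close>. Their product \<open>\<Phi>\<close> is bounded on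
  \<open>Y\<close> in terms of \<open>t\<close>, hence also at \<open>s\<close>, where its norm is
  known.\<close>

lemma pure_tensor_le_bound:
  assumes "pure_tensor s w" and "tensor_bound s t"
  shows "w \<le> t"
proof (cases "w = 0")
  case True
  have "0 \<le> t" using assms(2) by (induction rule: tensor_bound.induct) (use pure_tensor_nonneg in force)+
  then show ?thesis using True by simp
next
  case False
  obtain Y where Y: "finite Y" "\<And>y v. (y, v) \<in> Y \<Longrightarrow> pure_tensor y v \<and> v \<le> t"
    and bound: "dominates Y s"
    using tensor_bound_witnesses[OF assms(2)] by blast
  have "\<forall>p\<in>insert (s, w) Y. \<exists>W\<^sub>0 a z. decomposes (fst p) (snd p) W\<^sub>0 a z"
    using Y(2) assms(1) by (auto intro: pure_tensor_decomposes)
  then obtain W\<^sub>0 a z where canonical: "\<And>p. p \<in> insert (s, w) Y \<Longrightarrow> decomposes (fst p) (snd p) (W\<^sub>0 p) (a p) (z p)"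
    by metis
  define W where "W = (\<Union>p\<in>insert (s, w) Y. W\<^sub>0 p)"
  have W: "finite W" using Y(1) canonical by (auto simp: W_def decomposes_def)
  have eq: "fst p = Poly_Mapping.single 0 (a p) * (\<Prod>c\<in>W. index_poly c (z p c))"
    "snd p = n\<^sub>0 (a p) * (\<Prod>c\<in>W. n c (z p c))" if "p \<in> insert (s, w) Y" for p
    using canonical[OF that] W that unfolding decomposes_def W_def by blast+
  define q where "q = (s, w)"
  have w: "w = n\<^sub>0 (a q) * (\<Prod>c\<in>W. n c (z q c))" using eq(2)[of q] by (simp add: q_def)
  have nz: "n c (z q c) \<noteq> 0" if "c \<in> W" for c using False W that unfolding w by auto
  have "\<exists>u. n\<^sub>0 (pm_sum (\<lambda>m a. a * u m) (z q c)) \<noteq> 0 \<and> (\<forall>p\<in>Y. n\<^sub>0 (pm_sum (\<lambda>m a. a * u m) (z p c)) * n c (z q c)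
    \<le> n\<^sub>0 (pm_sum (\<lambda>m a. a * u m) (z q c)) * n c (z p c))" if "c \<in> W" for c
    using finite_hahn_banach_free[of n\<^sub>0 "n c" "(\<lambda>p. z p c) ` Y" "z q c"]
      n0.mult_seminorm_axioms n n_const Y(1) nz[OF that] by (metis finite_imageI imageI)
  then obtain u where u: "\<And>c. c \<in> W \<Longrightarrow> n\<^sub>0 (pm_sum (\<lambda>m a. a * u c m) (z q c)) \<noteq> 0"
    "\<And>c p. c \<in> W \<Longrightarrow> p \<in> Y \<Longrightarrow> n\<^sub>0 (pm_sum (\<lambda>m a. a * u c m) (z p c)) * n c (z q c)
    \<le> n\<^sub>0 (pm_sum (\<lambda>m a. a * u c m) (z q c)) * n c (z p c)" by metis
  define \<phi> where "\<phi> p c = n\<^sub>0 (pm_sum (\<lambda>m a. a * u c m) (z p c))" for p c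
  define \<Phi> where "\<Phi> = pm_sum (\<lambda>m a. a * (\<Prod>c\<in>W. u c (part_monom c m)))"
  have \<Phi>_diff: "\<Phi> (x - y) = \<Phi> x - \<Phi> y" for x y
    unfolding \<Phi>_def by (rule pm_sum_diff) (simp_all add: distrib_right)
  have \<Phi>: "n\<^sub>0 (\<Phi> (fst p)) = n\<^sub>0 (a p) * (\<Prod>c\<in>W. \<phi> p c)" if "p \<in> insert (s, w) Y" for p
    unfolding \<Phi>_def eq(1)[OF that] pm_sum_prod_index_poly[OF W] \<phi>_def by (simp add: n0.mult n0.prod)
  \<comment> \<open>Apart from the constant \<open>a q\<close>, the tensor \<open>s\<close> has
    weight \<open>A\<close> and its image under \<open>\<Phi>\<close> has norm \<open>B\<close>. By
    the choice of \<open>u\<close>, on each element of \<open>Y\<close> the norm of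
    \<open>\<Phi>\<close> is at most \<open>B / A\<close> times the weight.\<close>
  define A where "A = (\<Prod>c\<in>W. n c (z q c))"
  define B where "B = (\<Prod>c\<in>W. \<phi> q c)"
  have A: "0 < A" unfolding A_def using nz n_nonneg by (intro prod_pos) (simp add: less_le)
  have B: "0 < B" unfolding B_def using u(1) by (intro prod_pos) (simp add: less_le \<phi>_def)
  have "n\<^sub>0 (\<Phi> (fst p)) \<le> t * B / A" if p: "p \<in> Y" for p
  proof -
    have "(\<Prod>c\<in>W. \<phi> p c) * A \<le> B * (\<Prod>c\<in>W. n c (z p c))"
      unfolding A_def B_def prod.distrib[symmetric] using u(2) p n_nonneg
      by (intro prod_mono) (auto simp: \<phi>_def)
    then have "n\<^sub>0 (a p) * ((\<Prod>c\<in>W. \<phi> p c) * A) \<le> n\<^sub>0 (a p) * (B * (\<Prod>c\<in>W. n c (z p c)))"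
      by (rule mult_left_mono) simp
    also have "\<dots> = snd p * B" using eq(2)[of p] p by simp
    also have "\<dots> \<le> t * B" using Y(2)[of "fst p" "snd p"] p B by simp
    finally show ?thesis using A \<Phi>[of p] p by (simp add: field_simps)
  qed
  then have "n\<^sub>0 (\<Phi> s) \<le> t * B / A" using bound[unfolded dominates_def, rule_format, of \<Phi> "t * B / A"] \<Phi>_diff by blast
  then have "n\<^sub>0 (a q) * B \<le> t * B / A" using \<Phi>[of q] by (simp add: B_def q_def)
  then have "n\<^sub>0 (a q) * A \<le> t" using A B by (simp add: field_simps)
  then show ?thesis by (simp add: w A_def)
qed

lemma tensor_bound_mono: "tensor_bound x t \<Longrightarrow> t \<le> t' \<Longrightarrow> tensor_bound x t'"
  by (induction rule: tensor_bound.induct) (auto intro: tensor_bound.intros)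

lemma tensor_bound_zero: "0 \<le> t \<Longrightarrow> tensor_bound 0 t"
  using pure[OF const[of 0], of t] by simp

lemma tensor_bound_mult:
  assumes "tensor_bound x t" and "tensor_bound y t'" and "0 \<le> t"
  shows "tensor_bound (x * y) (t * t')"
  using assms
proof (induction rule: tensor_bound.induct)
  case (pure x w t)
  note x = pure
  from \<open>tensor_bound y t'\<close> show ?case
  proof (induction rule: tensor_bound.induct)
    case (pure y w' t')
    then have "w * w' \<le> t * t'" using x by (intro mult_mono) (auto intro: pure_tensor_nonneg)
    then show ?case using pure x by (auto intro: tensor_bound.pure pure_tensor_mult)
  qed (auto simp: right_diff_distrib intro: tensor_bound.diff)
qed (auto simp: left_diff_distrib intro: tensor_bound.diff)

lemma tensor_bound_nonneg: "tensor_bound x t \<Longrightarrow> 0 \<le> t"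
  by (induction rule: tensor_bound.induct) (use pure_tensor_nonneg in force)+

lemma pure_tensor_index_poly: "pure_tensor (index_poly c z) (n c z)"
  using step[OF const[of 1], of c z] by simp

text \<open>Each power of a variable lies in a single copy. As monomials span the ring, this
  provides a bound for every element, so that the infimum is over a nonempty set.\<close>

lemma pure_tensor_monom: "\<exists>w. pure_tensor (Poly_Mapping.single m a) w"
proof -
  have "\<exists>w. pure_tensor (Poly_Mapping.single (\<Sum>k\<in>K. Poly_Mapping.single k (e k)) a) w"
    if "finite K" for K and e :: "'c \<times> 'b \<Rightarrow> nat"
    using that
  proof (induction K rule: finite_induct)
    case empty
    then show ?case using const by auto
  next
    case (insert k K)
    obtain c b where k: "k = (c, b)" by (cases k)
    let ?m = "\<Sum>k\<in>K. Poly_Mapping.single k (e k)"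
    have "Poly_Mapping.single (\<Sum>k\<in>insert k K. Poly_Mapping.single k (e k)) a
      = Poly_Mapping.single ?m a * index_poly c (Poly_Mapping.single (Poly_Mapping.single b (e k)) 1)"
      using insert by (simp add: index_poly_single index_monom_single mult_single k add.commute)
    then show ?case using insert.IH step by metis
  qed
  then show ?thesis by (subst pm_expand[of m]) simp
qed

lemma tensor_bound_ex: "\<exists>t. tensor_bound x t"
proof -
  have add: "\<exists>t. tensor_bound (x + y) t" if "tensor_bound x t" "tensor_bound y t'" for x y t t'
  proof -
    let ?t = "max t t'"
    have "tensor_bound x ?t" "tensor_bound y ?t" "tensor_bound 0 ?t"
      using that tensor_bound_mono tensor_bound_nonneg[OF that(1)] by (auto intro: tensor_bound_zero)
    then have "tensor_bound (x - (0 - y)) ?t" by (intro diff)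
    then show ?thesis by auto
  qed
  have "\<exists>t. tensor_bound (\<Sum>m\<in>K. Poly_Mapping.single m (e m)) t" if "finite K" for K and e :: "_ \<Rightarrow> 'a"
    using that
  proof (induction K rule: finite_induct)
    case empty
    then show ?case using tensor_bound_zero by auto
  next
    case (insert m K)
    obtain w where "pure_tensor (Poly_Mapping.single m (e m)) w" using pure_tensor_monom by blast
    then have "tensor_bound (Poly_Mapping.single m (e m)) w" by (rule pure) simp
    then show ?case using insert add by auto
  qed
  then show ?thesis by (subst pm_expand[of x]) simp
qed

theorem amalgamation:
  obtains N where "mult_seminorm N" "\<And>a. N (Poly_Mapping.single 0 a) = n\<^sub>0 a"
    "\<And>c z. N (index_poly c z) = n c z"
proof -
  interpret gauge_rel tensor_bound
  proof
    show "0 \<le> t" if "tensor_bound x t" for x t by (rule tensor_bound_nonneg) fact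
    show "\<exists>t. tensor_bound x t" for x by (rule tensor_bound_ex)
    show "tensor_bound 0 0" by (rule tensor_bound_zero) simp
    show "tensor_bound (x - y) (max c d)" if "tensor_bound x c" "tensor_bound y d" for x c y d
      using that by (intro diff) (auto intro: tensor_bound_mono)
    show "tensor_bound (x * y) (c * d)" if "tensor_bound x c" "tensor_bound y d" for x c y d
      using that by (intro tensor_bound_mult tensor_bound_nonneg)
  qed
  have gauge_pure: "gauge s = w" if "pure_tensor s w" for s w
  proof (rule antisym)
    show "gauge s \<le> w" using that by (intro gauge_le pure) auto
    show "w \<le> gauge s" using that by (intro gauge_ge pure_tensor_le_bound)
  qed
  \<comment> \<open>Only positive weights are prescribed; on pure tensors of weight 0 the bound by
    \<open>gauge\<close> already forces the value of \<open>N\<close>.\<close>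
  define T where "T = {(s, w). pure_tensor s w \<and> 0 < w}"
  have T: "weighted_monoid T"
    using const[of 1] pure_tensor_mult unfolding weighted_monoid_def T_def by auto
  obtain N where N: "mult_seminorm N" "\<And>x. N x \<le> gauge x" "\<And>s w. (s, w) \<in> T \<Longrightarrow> N s = w"
    using multiplicative_seminorm_below[OF ring_seminorm_axioms T] gauge_pure
    by (auto simp: T_def)
  interpret N: mult_seminorm N by fact
  have "N s = w" if s: "pure_tensor s w" for s w
  proof (cases "w = 0")
    case True
    then show ?thesis using N(2)[of s] gauge_pure[OF s] N.nonneg[of s] by simp
  next
    case False
    then show ?thesis using N(3)[of s w] s pure_tensor_nonneg[OF s] by (simp add: T_def)
  qed
  then show thesis using that N(1) const pure_tensor_index_poly by blast
qed

end

subsection \<open>Evaluation of polynomials and quotients\<close>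

definition monom_eval :: "('x \<Rightarrow> 'd::comm_ring_1) \<Rightarrow> ('x \<Rightarrow>\<^sub>0 nat) \<Rightarrow> 'd" where
  "monom_eval e m = (\<Prod>x\<in>Poly_Mapping.keys m. e x ^ Poly_Mapping.lookup m x)"

lemma monom_eval_superset:
  assumes "finite F" "Poly_Mapping.keys m \<subseteq> F"
  shows "monom_eval e m = (\<Prod>x\<in>F. e x ^ Poly_Mapping.lookup m x)"
  unfolding monom_eval_def using assms by (intro prod.mono_neutral_left) (auto simp: in_keys_iff)

lemma monom_eval_add: "monom_eval e (m + m') = monom_eval e m * monom_eval e m'"
proof -
  let ?F = "Poly_Mapping.keys m \<union> Poly_Mapping.keys m'"
  have "finite ?F" "Poly_Mapping.keys (m + m') \<subseteq> ?F" by (simp_all add: Poly_Mapping.keys_add)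
  then show ?thesis
    by (simp add: monom_eval_superset[of ?F] lookup_add power_add prod.distrib)
qed

definition int_poly_eval :: "('x \<Rightarrow> 'd::comm_ring_1) \<Rightarrow> (('x \<Rightarrow>\<^sub>0 nat) \<Rightarrow>\<^sub>0 int) \<Rightarrow> 'd" where
  "int_poly_eval e p = pm_sum (\<lambda>m a. of_int a * monom_eval e m) p"

definition var :: "'x \<Rightarrow> (('x \<Rightarrow>\<^sub>0 nat) \<Rightarrow>\<^sub>0 'a::comm_ring_1)" where
  "var x = Poly_Mapping.single (Poly_Mapping.single x 1) 1"

lemma int_poly_eval_diff: "int_poly_eval e (p - q) = int_poly_eval e p - int_poly_eval e q"
  unfolding int_poly_eval_def by (rule pm_sum_diff) (simp_all add: distrib_right)

lemma int_poly_eval_add: "int_poly_eval e (p + q) = int_poly_eval e p + int_poly_eval e q"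
  unfolding int_poly_eval_def by (rule pm_sum_add) (simp_all add: distrib_right)

lemma int_poly_eval_mult: "int_poly_eval e (p * q) = int_poly_eval e p * int_poly_eval e q"
  unfolding int_poly_eval_def
  by (rule pm_sum_mult) (simp_all add: distrib_right distrib_left monom_eval_add mult_ac)

lemma int_poly_eval_zero [simp]: "int_poly_eval e 0 = 0"
  by (simp add: int_poly_eval_def)

lemma int_poly_eval_one [simp]: "int_poly_eval e 1 = 1"
proof -
  have "int_poly_eval e (Poly_Mapping.single 0 1) = 1"
    unfolding int_poly_eval_def by (subst pm_sum_single) (simp_all add: monom_eval_def)
  then show ?thesis by simp
qed

lemma int_poly_eval_var [simp]: "int_poly_eval e (var x) = e x"
  unfolding int_poly_eval_def var_def by (subst pm_sum_single) (simp_all add: monom_eval_def)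

lemma mult_seminorm_int_poly_eval:
  assumes "mult_seminorm N"
  shows "mult_seminorm (\<lambda>p. N (int_poly_eval e p))"
proof -
  interpret mult_seminorm N by fact
  show ?thesis
    by unfold_locales (simp_all add: int_poly_eval_diff int_poly_eval_mult mult diff_le)
qed

text \<open>The bridge between two styles of rings: polynomial rings are instances of a type class,
  whereas \<open>k\<close> and \<open>R\<close> have carriers. Valuations are pulled back along such
  maps.\<close>

locale class_ring_hom = cring R for R (structure) +
  fixes g :: "'c::comm_ring_1 \<Rightarrow> 'a"
  assumes closed [simp]: "g a \<in> carrier R"
    and one [simp]: "g 1 = \<one>"
    and add: "g (a + b) = g a \<oplus> g b"
    and mult: "g (a * b) = g a \<otimes> g b"
begin

lemma zero [simp]: "g 0 = \<zero>"
  using add[of 0 0] by (metis add.l_cancel_one closed add_0)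

lemma diff: "g (a - b) = g a \<ominus> g b"
  using add[of "a - b" b] by (simp add: minus_eq a_assoc r_neg)

end

lemma (in cring) class_ring_hom_of_int: "class_ring_hom R (\<lambda>i::int. [i] \<cdot> \<one>)"
proof
  fix a b :: int
  show "[a] \<cdot> \<one> \<in> carrier R" by simp
  show "[(1::int)] \<cdot> \<one> = \<one>" using add.int_pow_1 by simp
  show "[(a + b)] \<cdot> \<one> = [a] \<cdot> \<one> \<oplus> [b] \<cdot> \<one>" using add.int_pow_mult by simp
  show "[(a * b)] \<cdot> \<one> = [a] \<cdot> \<one> \<otimes> [b] \<cdot> \<one>"
    using add_pow_ldistr_int[of \<one> "[b] \<cdot> \<one>" a] add.int_pow_pow[of \<one> a b] by (simp add: mult.commute)
qed

section \<open>Evaluation of polynomials in a ring with a carrier\<close>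

definition (in cring) carrier_monom_eval :: "('x \<Rightarrow> 'a) \<Rightarrow> ('x \<Rightarrow>\<^sub>0 nat) \<Rightarrow> 'a" where
  "carrier_monom_eval e m = (\<Otimes>x\<in>Poly_Mapping.keys m. e x [^] Poly_Mapping.lookup m x)"

definition (in class_ring_hom) carrier_poly_eval :: "('x \<Rightarrow> 'a) \<Rightarrow> (('x \<Rightarrow>\<^sub>0 nat) \<Rightarrow>\<^sub>0 'c) \<Rightarrow> 'a" where
  "carrier_poly_eval e p =
    (\<Oplus>m\<in>Poly_Mapping.keys p. g (Poly_Mapping.lookup p m) \<otimes> carrier_monom_eval e m)"

context cring
begin

lemma carrier_monom_eval_superset:
  assumes "finite F" "Poly_Mapping.keys m \<subseteq> F" "\<And>x. e x \<in> carrier R"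
  shows "carrier_monom_eval e m = (\<Otimes>x\<in>F. e x [^] Poly_Mapping.lookup m x)"
  unfolding carrier_monom_eval_def using assms
  by (intro finprod_mono_neutral_cong_left) (auto simp: in_keys_iff)

lemma carrier_monom_eval_closed [simp]:
  "(\<And>x. e x \<in> carrier R) \<Longrightarrow> carrier_monom_eval e m \<in> carrier R"
  unfolding carrier_monom_eval_def by (rule finprod_closed) auto

lemma carrier_monom_eval_add:
  assumes e: "\<And>x. e x \<in> carrier R"
  shows "carrier_monom_eval e (m + m') = carrier_monom_eval e m \<otimes> carrier_monom_eval e m'"
proof -
  let ?F = "Poly_Mapping.keys m \<union> Poly_Mapping.keys m'"
  have "finite ?F" "Poly_Mapping.keys (m + m') \<subseteq> ?F" by (simp_all add: Poly_Mapping.keys_add)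
  then show ?thesis
    using e by (simp add: carrier_monom_eval_superset[of ?F] lookup_add nat_pow_mult[symmetric] finprod_multf)
qed

end

context class_ring_hom
begin

lemma carrier_poly_eval_superset:
  assumes "finite F" "Poly_Mapping.keys p \<subseteq> F" "\<And>x. e x \<in> carrier R"
  shows "carrier_poly_eval e p =
    (\<Oplus>m\<in>F. g (Poly_Mapping.lookup p m) \<otimes> carrier_monom_eval e m)"
  unfolding carrier_poly_eval_def using assms
  by (intro add.finprod_mono_neutral_cong_left) (auto simp: in_keys_iff)

lemma carrier_poly_eval_single:
  assumes "\<And>x. e x \<in> carrier R"
  shows "carrier_poly_eval e (Poly_Mapping.single m a) = g a \<otimes> carrier_monom_eval e m"
proof -
  have "Poly_Mapping.keys (Poly_Mapping.single m a) \<subseteq> {m}" by simp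
  then show ?thesis using assms by (simp add: carrier_poly_eval_superset[of "{m}"])
qed

lemma carrier_poly_eval_add:
  assumes "\<And>x. e x \<in> carrier R"
  shows "carrier_poly_eval e (p + q) = carrier_poly_eval e p \<oplus> carrier_poly_eval e q"
proof -
  let ?F = "Poly_Mapping.keys p \<union> Poly_Mapping.keys q"
  have "finite ?F" "Poly_Mapping.keys (p + q) \<subseteq> ?F" by (simp_all add: Poly_Mapping.keys_add)
  then show ?thesis
    using assms by (simp add: carrier_poly_eval_superset[of ?F] lookup_add add l_distr finsum_addf)
qed

lemma carrier_poly_eval_closed [simp]:
  assumes "\<And>x. e x \<in> carrier R"
  shows "carrier_poly_eval e p \<in> carrier R"
  unfolding carrier_poly_eval_def using assms by (intro finsum_closed) auto

lemma carrier_poly_eval_mult: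
  fixes e :: "'x \<Rightarrow> 'a"
  assumes e: "\<And>x. e x \<in> carrier R"
  shows "carrier_poly_eval e (p * q) = carrier_poly_eval e p \<otimes> carrier_poly_eval e q"
proof -
  let ?ev = "carrier_poly_eval e"
  have ev_0: "?ev 0 = \<zero>" by (simp add: carrier_poly_eval_def)
  \<comment> \<open>Used twice: with a single term as right factor, and then, after exchanging the
    factors, with an arbitrary one.\<close>
  have sum: "?ev ((\<Sum>m\<in>K. f m) * q) = ?ev (\<Sum>m\<in>K. f m) \<otimes> ?ev q"
    if "finite K" "\<And>m. ?ev (f m * q) = ?ev (f m) \<otimes> ?ev q" for K :: "('x \<Rightarrow>\<^sub>0 nat) set" and f and q
    using that by (induction K rule: finite_induct)
      (simp_all add: ev_0 e distrib_right carrier_poly_eval_add l_distr)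
  have single: "?ev (Poly_Mapping.single m a * Poly_Mapping.single m' b)
      = ?ev (Poly_Mapping.single m a) \<otimes> ?ev (Poly_Mapping.single m' b)" for m m' a b
    by (simp add: mult_single carrier_poly_eval_single e mult carrier_monom_eval_add m_ac)
  have "?ev (q * Poly_Mapping.single m a) = ?ev q \<otimes> ?ev (Poly_Mapping.single m a)" for m a
    using sum[of "Poly_Mapping.keys q" "\<lambda>m. Poly_Mapping.single m (Poly_Mapping.lookup q m)"
        "Poly_Mapping.single m a"] single
    by (simp add: pm_expand[symmetric])
  then have "?ev (Poly_Mapping.single m a * q) = ?ev (Poly_Mapping.single m a) \<otimes> ?ev q" for m a
    by (simp add: mult.commute m_comm e)
  then show ?thesis
    using sum[of "Poly_Mapping.keys p" "\<lambda>m. Poly_Mapping.single m (Poly_Mapping.lookup p m)" q]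
    by (simp add: pm_expand[symmetric])
qed

lemma carrier_poly_eval_const:
  assumes "\<And>x. e x \<in> carrier R"
  shows "carrier_poly_eval e (Poly_Mapping.single 0 a) = g a"
  using assms by (simp add: carrier_poly_eval_single carrier_monom_eval_def)

lemma carrier_poly_eval_var:
  assumes "\<And>x. e x \<in> carrier R"
  shows "carrier_poly_eval e (var x) = e x"
  using assms by (simp add: var_def carrier_poly_eval_single carrier_monom_eval_def)

lemma class_ring_hom_carrier_poly_eval:
  assumes "\<And>x. e x \<in> carrier R"
  shows "class_ring_hom R (carrier_poly_eval e)"
  using assms carrier_poly_eval_const[of e 1]
  by unfold_locales (simp_all add: carrier_poly_eval_add carrier_poly_eval_mult)

end

section \<open>Passage between valuations and norms\<close>

definition abs_of_val :: "ereal \<Rightarrow> real" where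
  "abs_of_val e = (if e = \<infinity> then 0 else exp (- real_of_ereal e))"

definition val_of_abs :: "real \<Rightarrow> ereal" where
  "val_of_abs r = (if r = 0 then \<infinity> else ereal (- ln r))"

text \<open>At minus infinity \<open>real_of_ereal\<close> returns 0, so the norm would be 1 and the
  value could not be recovered.\<close>

lemma val_of_abs_of_val: "e \<noteq> - \<infinity> \<Longrightarrow> val_of_abs (abs_of_val e) = e"
  by (cases e) (simp_all add: abs_of_val_def val_of_abs_def)

lemma abs_of_val_nonneg: "0 \<le> abs_of_val e"
  by (simp add: abs_of_val_def)

lemma abs_of_val_antimono: "e \<noteq> - \<infinity> \<Longrightarrow> e \<le> e' \<Longrightarrow> abs_of_val e' \<le> abs_of_val e"
  by (cases e; cases e') (simp_all add: abs_of_val_def)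

lemma abs_of_val_add:
  "e \<noteq> - \<infinity> \<Longrightarrow> e' \<noteq> - \<infinity> \<Longrightarrow> abs_of_val (e + e') = abs_of_val e * abs_of_val e'"
  by (cases e; cases e') (simp_all add: abs_of_val_def exp_add[symmetric])

lemma val_of_abs_mult: "0 \<le> r \<Longrightarrow> 0 \<le> s \<Longrightarrow> val_of_abs (r * s) = val_of_abs r + val_of_abs s"
  by (auto simp: val_of_abs_def ln_mult)

lemma val_of_abs_antimono: "0 \<le> s \<Longrightarrow> s \<le> r \<Longrightarrow> val_of_abs r \<le> val_of_abs s"
  by (auto simp: val_of_abs_def)

context real_valuation
begin

text \<open>The square of minus one is one, so twice its value is 0, which leaves only the value
  0.\<close>

lemma val_a_inv: "x \<in> carrier R \<Longrightarrow> v (\<ominus> x) = v x"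
proof -
  have "v (\<ominus> \<one>) + v (\<ominus> \<one>) = 0" using val_mult[of "\<ominus> \<one>" "\<ominus> \<one>"] val_one by (simp add: l_minus)
  then have "v (\<ominus> \<one>) = 0" by (cases "v (\<ominus> \<one>)") (auto simp: zero_ereal_def)
  moreover assume "x \<in> carrier R"
  ultimately show ?thesis using val_mult[of "\<ominus> \<one>" x] by (simp add: l_minus)
qed

lemma mult_seminorm_abs:
  assumes "class_ring_hom R g"
  shows "mult_seminorm (\<lambda>p. abs_of_val (v (g p)))"
proof -
  interpret g: class_ring_hom R g by fact
  show ?thesis
  proof
    fix x y
    have "min (v (g x)) (v (g y)) \<le> v (g (x - y))"
      using val_add[of "g x" "\<ominus> g y"] by (simp add: g.diff minus_eq val_a_inv)
    then have "v (g x) \<le> v (g (x - y)) \<or> v (g y) \<le> v (g (x - y))" by (auto simp: min_def split: if_splits)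
    then show "abs_of_val (v (g (x - y))) \<le> max (abs_of_val (v (g x))) (abs_of_val (v (g y)))"
      using abs_of_val_antimono val_not_MInf by (auto simp: le_max_iff_disj)
  qed (simp_all add: g.mult val_mult val_zero val_one abs_of_val_nonneg abs_of_val_add val_not_MInf,
      simp_all add: abs_of_val_def)
qed

end

section \<open>The quotient by the elements of norm 0\<close>

context mult_seminorm
begin

definition coset :: "'a \<Rightarrow> 'a set" where
  "coset p = {q. N (q - p) = 0}"

definition rep :: "'a set \<Rightarrow> 'a" where
  "rep S = (SOME p. p \<in> S)"

definition quotient_algebra :: "('k \<Rightarrow> 'a) \<Rightarrow> ('k, 'a set) module" where
  "quotient_algebra \<sigma> = \<lparr>carrier = range coset, mult = \<lambda>S T. coset (rep S * rep T), one = coset 1,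
    zero = coset 0, add = \<lambda>S T. coset (rep S + rep T), smult = \<lambda>a S. coset (\<sigma> a * rep S)\<rparr>"

lemma null_add: "N x = 0 \<Longrightarrow> N y = 0 \<Longrightarrow> N (x + y) = 0"
  using add_le[of x y] nonneg[of "x + y"] by simp

lemma coset_eqI: "N (p - q) = 0 \<Longrightarrow> coset p = coset q"
proof -
  assume *: "N (p - q) = 0"
  then have "N (q - p) = 0" using minus[of "p - q"] by simp
  then show ?thesis
    using * null_add[of "_ - p" "p - q"] null_add[of "_ - q" "q - p"] by (auto simp: coset_def)
qed

lemma rep_coset: "N (rep (coset p) - p) = 0"
proof -
  have "p \<in> coset p" by (simp add: coset_def)
  then have "rep (coset p) \<in> coset p" unfolding rep_def by (rule someI)
  then show ?thesis by (simp add: coset_def)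
qed

lemma coset_rep_add: "coset (rep (coset p) + rep (coset q)) = coset (p + q)"
  using null_add[OF rep_coset[of p] rep_coset[of q]] by (intro coset_eqI) (simp add: algebra_simps)

lemma coset_mult_rep: "coset (p * rep (coset q)) = coset (p * q)"
  using rep_coset[of q] by (intro coset_eqI) (simp add: right_diff_distrib[symmetric] mult)

lemma coset_rep_mult: "coset (rep (coset p) * q) = coset (p * q)"
  using coset_mult_rep by (metis mult.commute)

lemma coset_rep: "coset (rep (coset p)) = coset p"
  by (rule coset_eqI[OF rep_coset])

lemmas quotient_simps = coset_rep_add coset_mult_rep coset_rep_mult coset_rep

lemma cring_quotient: "cring (quotient_algebra \<sigma>)"
proof (rule cringI)
  show "abelian_group (quotient_algebra \<sigma>)"
  proof (rule abelian_groupI)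
    fix S assume "S \<in> carrier (quotient_algebra \<sigma>)"
    then obtain p where "S = coset p" by (auto simp: quotient_algebra_def)
    then show "\<exists>T\<in>carrier (quotient_algebra \<sigma>). T \<oplus>\<^bsub>quotient_algebra \<sigma>\<^esub> S = \<zero>\<^bsub>quotient_algebra \<sigma>\<^esub>"
      by (intro bexI[of _ "coset (- p)"]) (auto simp: quotient_algebra_def quotient_simps)
  qed (auto simp: quotient_algebra_def quotient_simps add_ac)
  show "comm_monoid (quotient_algebra \<sigma>)"
    by (rule comm_monoidI) (auto simp: quotient_algebra_def quotient_simps mult_ac)
qed (auto simp: quotient_algebra_def quotient_simps distrib_right)

text \<open>Passing to cosets kills null elements, so \<open>\<sigma>\<close> has to be a
  homomorphism only up to norm 0. It will be the map sending \<open>a\<close> to a variable, which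
  is not additive in the polynomial ring itself.\<close>

lemma algebra_quotient:
  assumes "cring k"
    and "\<And>a b. a \<in> carrier k \<Longrightarrow> b \<in> carrier k \<Longrightarrow> N (\<sigma> (a \<oplus>\<^bsub>k\<^esub> b) - (\<sigma> a + \<sigma> b)) = 0"
    and "\<And>a b. a \<in> carrier k \<Longrightarrow> b \<in> carrier k \<Longrightarrow> N (\<sigma> (a \<otimes>\<^bsub>k\<^esub> b) - \<sigma> a * \<sigma> b) = 0"
    and "N (\<sigma> \<one>\<^bsub>k\<^esub> - 1) = 0"
  shows "algebra k (quotient_algebra \<sigma>)"
proof (rule algebraI)
  have eq: "coset (p * r) = coset (q * r)" if "N (p - q) = 0" for p q r
    using that by (intro coset_eqI) (simp add: left_diff_distrib[symmetric] mult)
  note hom = assms(2-4)[THEN eq]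
  fix a b x y
  assume x: "x \<in> carrier (quotient_algebra \<sigma>)"
  then obtain p where p: "x = coset p" by (auto simp: quotient_algebra_def)
  show "\<one>\<^bsub>k\<^esub> \<odot>\<^bsub>quotient_algebra \<sigma>\<^esub> x = x"
    using hom(3) p by (simp add: quotient_algebra_def quotient_simps)
  assume a: "a \<in> carrier k"
  show "a \<odot>\<^bsub>quotient_algebra \<sigma>\<^esub> x \<in> carrier (quotient_algebra \<sigma>)"
    by (simp add: quotient_algebra_def)
  {
    assume b: "b \<in> carrier k"
    show "(a \<oplus>\<^bsub>k\<^esub> b) \<odot>\<^bsub>quotient_algebra \<sigma>\<^esub> x
      = a \<odot>\<^bsub>quotient_algebra \<sigma>\<^esub> x \<oplus>\<^bsub>quotient_algebra \<sigma>\<^esub> b \<odot>\<^bsub>quotient_algebra \<sigma>\<^esub> x"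
      using hom(1)[OF a b] p
      by (simp add: quotient_algebra_def quotient_simps) (simp add: distrib_right)
    show "(a \<otimes>\<^bsub>k\<^esub> b) \<odot>\<^bsub>quotient_algebra \<sigma>\<^esub> x = a \<odot>\<^bsub>quotient_algebra \<sigma>\<^esub> (b \<odot>\<^bsub>quotient_algebra \<sigma>\<^esub> x)"
      using hom(2)[OF a b] p
      by (simp add: quotient_algebra_def quotient_simps) (simp add: mult_ac)
  }
  assume "y \<in> carrier (quotient_algebra \<sigma>)"
  then obtain q where q: "y = coset q" by (auto simp: quotient_algebra_def)
  show "a \<odot>\<^bsub>quotient_algebra \<sigma>\<^esub> (x \<oplus>\<^bsub>quotient_algebra \<sigma>\<^esub> y)
    = a \<odot>\<^bsub>quotient_algebra \<sigma>\<^esub> x \<oplus>\<^bsub>quotient_algebra \<sigma>\<^esub> a \<odot>\<^bsub>quotient_algebra \<sigma>\<^esub> y"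
    using p q by (simp add: quotient_algebra_def quotient_simps distrib_left)
  show "(a \<odot>\<^bsub>quotient_algebra \<sigma>\<^esub> x) \<otimes>\<^bsub>quotient_algebra \<sigma>\<^esub> y
    = a \<odot>\<^bsub>quotient_algebra \<sigma>\<^esub> (x \<otimes>\<^bsub>quotient_algebra \<sigma>\<^esub> y)"
    using p q by (simp add: quotient_algebra_def quotient_simps) (simp add: mult_ac)
qed (fact assms cring_quotient)+

definition quotient_val :: "'a set \<Rightarrow> ereal" where
  "quotient_val S = val_of_abs (N (rep S))"

lemma quotient_val_coset: "quotient_val (coset p) = val_of_abs (N p)"
  unfolding quotient_val_def using eq_of_diff_zero[OF rep_coset] by simp

lemma real_valuation_quotient: "real_valuation (quotient_algebra \<sigma>) quotient_val"
proof -
  interpret Q: cring "quotient_algebra \<sigma>" by (rule cring_quotient)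
  have carrier: "carrier (quotient_algebra \<sigma>) = range coset" by (simp add: quotient_algebra_def)
  show ?thesis
  proof
    fix x y assume "x \<in> carrier (quotient_algebra \<sigma>)" "y \<in> carrier (quotient_algebra \<sigma>)"
    then obtain p q where xy: "x = coset p" "y = coset q" by (auto simp: carrier)
    show "quotient_val (x \<otimes>\<^bsub>quotient_algebra \<sigma>\<^esub> y) = quotient_val x + quotient_val y"
      by (simp add: xy quotient_algebra_def quotient_simps quotient_val_coset mult val_of_abs_mult)
    have "N (p + q) \<le> N p \<or> N (p + q) \<le> N q" using add_le[of p q] by linarith
    then show "min (quotient_val x) (quotient_val y) \<le> quotient_val (x \<oplus>\<^bsub>quotient_algebra \<sigma>\<^esub> y)"
      by (auto simp: xy quotient_algebra_def quotient_simps quotient_val_coset min_le_iff_disj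
          intro: val_of_abs_antimono)
  qed (auto simp: quotient_algebra_def quotient_val_coset, auto simp: val_of_abs_def split: if_splits)
qed

lemma quotient_algebra_hom:
  fixes R :: "('k, 'r, 'm) module_scheme"
  assumes "\<And>r s. r \<in> carrier R \<Longrightarrow> s \<in> carrier R \<Longrightarrow> N (\<tau> (r \<oplus>\<^bsub>R\<^esub> s) - (\<tau> r + \<tau> s)) = 0"
    and "\<And>r s. r \<in> carrier R \<Longrightarrow> s \<in> carrier R \<Longrightarrow> N (\<tau> (r \<otimes>\<^bsub>R\<^esub> s) - \<tau> r * \<tau> s) = 0"
    and "N (\<tau> \<one>\<^bsub>R\<^esub> - 1) = 0"
    and "\<And>a r. a \<in> carrier k \<Longrightarrow> r \<in> carrier R \<Longrightarrow> N (\<tau> (a \<odot>\<^bsub>R\<^esub> r) - \<sigma> a * \<tau> r) = 0"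
  shows "(\<lambda>r. coset (\<tau> r)) \<in> algebra_hom k R (quotient_algebra \<sigma>)"
  unfolding algebra_hom_def ring_hom_def
  using assms[THEN coset_eqI] by (simp add: quotient_algebra_def quotient_simps)

end

section \<open>Construction of the algebra \<open>K\<close>\<close>

lemma class_ring_hom_compose:
  assumes "class_ring_hom R g" and "cring S"
    and closed: "\<And>x. x \<in> carrier R \<Longrightarrow> h x \<in> carrier S"
    and one: "h \<one>\<^bsub>R\<^esub> = \<one>\<^bsub>S\<^esub>"
    and add: "\<And>x y. x \<in> carrier R \<Longrightarrow> y \<in> carrier R \<Longrightarrow> h (x \<oplus>\<^bsub>R\<^esub> y) = h x \<oplus>\<^bsub>S\<^esub> h y"
    and mult: "\<And>x y. x \<in> carrier R \<Longrightarrow> y \<in> carrier R \<Longrightarrow> h (x \<otimes>\<^bsub>R\<^esub> y) = h x \<otimes>\<^bsub>S\<^esub> h y"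
  shows "class_ring_hom S (\<lambda>a. h (g a))"
proof -
  interpret R: class_ring_hom R g by fact
  interpret S: cring S by fact
  show ?thesis by unfold_locales (simp_all add: assms(3-6) R.add R.mult)
qed

theorem theorem2p7:
  fixes k :: "('a, 'l) ring_scheme"
    and \<nu> :: "'a \<Rightarrow> ereal"
    and R :: "('a, 'b, 'm) module_scheme"
  assumes "cring k"
    and "real_valuation k \<nu>"
    and "algebra k R"
  shows "\<exists>(K :: ('a, ('a, 'b) coset_type) module) (\<mu> :: ('a, 'b) coset_type \<Rightarrow> ereal).
           algebra k K \<and> real_valuation K \<mu> \<and> extends_val k \<nu> K \<mu> \<and>
           (\<forall>v\<in>val_extensions k \<nu> R. \<exists>f\<in>algebra_hom k R K. \<forall>x\<in>carrier R. v x = (\<mu> \<circ> f) x)"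
proof -
  interpret k: real_valuation k \<nu> by fact
  interpret R: algebra k R by fact
  \<comment> \<open>There is a variable for every element of the type; those outside the carrier are
    evaluated to zero so that evaluation stays in the ring.\<close>
  define e\<^sub>k where "e\<^sub>k a = (if a \<in> carrier k then a else \<zero>\<^bsub>k\<^esub>)" for a
  define e\<^sub>R where "e\<^sub>R r = (if r \<in> carrier R then r else \<zero>\<^bsub>R\<^esub>)" for r
  have e\<^sub>k: "e\<^sub>k a \<in> carrier k" and e\<^sub>R: "e\<^sub>R r \<in> carrier R" for a r
    by (simp_all add: e\<^sub>k_def e\<^sub>R_def)
  interpret Z: class_ring_hom k "\<lambda>i::int. [i] \<cdot>\<^bsub>k\<^esub> \<one>\<^bsub>k\<^esub>" by (rule k.class_ring_hom_of_int)
  define ev\<^sub>k where "ev\<^sub>k = Z.carrier_poly_eval e\<^sub>k"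
  interpret E: class_ring_hom k ev\<^sub>k
    unfolding ev\<^sub>k_def by (rule Z.class_ring_hom_carrier_poly_eval) (rule e\<^sub>k)
  have ev\<^sub>k_var: "ev\<^sub>k (var a) = a" if "a \<in> carrier k" for a
    using Z.carrier_poly_eval_var[of e\<^sub>k a] e\<^sub>k that by (simp add: ev\<^sub>k_def e\<^sub>k_def)
  define \<sigma> where "\<sigma> = structure_map R"
  have "class_ring_hom R (\<lambda>p. \<sigma> (ev\<^sub>k p))"
    by (rule class_ring_hom_compose[OF E.class_ring_hom_axioms R.M_cring])
      (simp_all add: \<sigma>_def structure_map_def R.smult_l_distr R.smult_assoc1 R.smult_assoc2)
  then interpret S: class_ring_hom R "\<lambda>p. \<sigma> (ev\<^sub>k p)" .
  define ev\<^sub>R where "ev\<^sub>R = S.carrier_poly_eval e\<^sub>R"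
  interpret F: class_ring_hom R ev\<^sub>R
    unfolding ev\<^sub>R_def by (rule S.class_ring_hom_carrier_poly_eval) (rule e\<^sub>R)
  have ev\<^sub>R_var: "ev\<^sub>R (var r) = r" if "r \<in> carrier R" for r
    using S.carrier_poly_eval_var[of e\<^sub>R r] e\<^sub>R that by (simp add: ev\<^sub>R_def e\<^sub>R_def)
  have ev\<^sub>R_const: "ev\<^sub>R (Poly_Mapping.single 0 p) = \<sigma> (ev\<^sub>k p)" for p
    using S.carrier_poly_eval_const[of e\<^sub>R p] e\<^sub>R by (simp add: ev\<^sub>R_def)
  define n\<^sub>0 where "n\<^sub>0 p = abs_of_val (\<nu> (ev\<^sub>k p))" for p
  have n\<^sub>0: "mult_seminorm n\<^sub>0"
    unfolding n\<^sub>0_def by (rule k.mult_seminorm_abs) (rule E.class_ring_hom_axioms)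
  have n\<^sub>0_null: "n\<^sub>0 p = 0" if "ev\<^sub>k p = \<zero>\<^bsub>k\<^esub>" for p
    using that by (simp add: n\<^sub>0_def k.val_zero abs_of_val_def)
  define x where "x a = (var (Inl a) :: ('a + ('b \<Rightarrow> ereal) \<times> 'b \<Rightarrow>\<^sub>0 nat) \<Rightarrow>\<^sub>0 int)" for a
  define y where "y v r = (var (Inr (v, r)) :: ('a + ('b \<Rightarrow> ereal) \<times> 'b \<Rightarrow>\<^sub>0 nat) \<Rightarrow>\<^sub>0 int)" for v r
  have k_rel: "n\<^sub>0 (var a) = abs_of_val (\<nu> a)" "n\<^sub>0 (var (a \<oplus>\<^bsub>k\<^esub> b) - (var a + var b)) = 0"
    "n\<^sub>0 (var (a \<otimes>\<^bsub>k\<^esub> b) - var a * var b) = 0"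
    if "a \<in> carrier k" "b \<in> carrier k" for a b
    using that by (auto intro!: n\<^sub>0_null simp: E.diff E.add E.mult ev\<^sub>k_var k.minus_eq k.r_neg n\<^sub>0_def[of "var a"])
  have k_one: "n\<^sub>0 (var \<one>\<^bsub>k\<^esub> - 1) = 0"
    by (auto intro!: n\<^sub>0_null simp: E.diff ev\<^sub>k_var k.minus_eq k.r_neg)
  obtain N where N: "mult_seminorm N"
    and N_k: "\<And>a. a \<in> carrier k \<Longrightarrow> N (x a) = abs_of_val (\<nu> a)"
      "\<And>a b. a \<in> carrier k \<Longrightarrow> b \<in> carrier k \<Longrightarrow> N (x (a \<oplus>\<^bsub>k\<^esub> b) - (x a + x b)) = 0"
      "\<And>a b. a \<in> carrier k \<Longrightarrow> b \<in> carrier k \<Longrightarrow> N (x (a \<otimes>\<^bsub>k\<^esub> b) - x a * x b) = 0"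
      "N (x \<one>\<^bsub>k\<^esub> - 1) = 0"
    and N_R: "\<And>v r. v \<in> val_extensions k \<nu> R \<Longrightarrow> r \<in> carrier R \<Longrightarrow> N (y v r) = abs_of_val (v r)"
      "\<And>v r s. v \<in> val_extensions k \<nu> R \<Longrightarrow> r \<in> carrier R \<Longrightarrow> s \<in> carrier R \<Longrightarrow>
        N (y v (r \<oplus>\<^bsub>R\<^esub> s) - (y v r + y v s)) = 0"
      "\<And>v r s. v \<in> val_extensions k \<nu> R \<Longrightarrow> r \<in> carrier R \<Longrightarrow> s \<in> carrier R \<Longrightarrow>
        N (y v (r \<otimes>\<^bsub>R\<^esub> s) - y v r * y v s) = 0"
      "\<And>v. v \<in> val_extensions k \<nu> R \<Longrightarrow> N (y v \<one>\<^bsub>R\<^esub> - 1) = 0"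
      "\<And>v a r. v \<in> val_extensions k \<nu> R \<Longrightarrow> a \<in> carrier k \<Longrightarrow> r \<in> carrier R \<Longrightarrow>
        N (y v (a \<odot>\<^bsub>R\<^esub> r) - x a * y v r) = 0"
  \<comment> \<open>If nothing extends \<open>\<nu>\<close>, an algebra carrying an extension of
    \<open>\<nu>\<close> is still required: the variables \<open>y v r\<close> are sent to 0 and
    \<open>n\<^sub>0\<close> is pulled back.\<close>
  proof (cases "val_extensions k \<nu> R = {}")
    case True
    show ?thesis
    proof (rule that[OF mult_seminorm_int_poly_eval[OF n\<^sub>0, of "case_sum var (\<lambda>_. 0)"]])
    qed (use True k_rel k_one in \<open>simp_all add: x_def int_poly_eval_diff int_poly_eval_add int_poly_eval_mult\<close>)
  next
    case False
    then obtain v\<^sub>0 where v\<^sub>0: "v\<^sub>0 \<in> val_extensions k \<nu> R" by blast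
    \<comment> \<open>The family is indexed by all functions of the type, so indices that are not
      extensions receive the default \<open>v\<^sub>0\<close>.\<close>
    define c where "c v = (if v \<in> val_extensions k \<nu> R then v else v\<^sub>0)" for v
    have c: "c v \<in> val_extensions k \<nu> R" for v using v\<^sub>0 by (simp add: c_def)
    define n where "n v p = abs_of_val (c v (ev\<^sub>R p))" for v p
    interpret seminorm_family n\<^sub>0 n
    proof (intro seminorm_family.intro n\<^sub>0 seminorm_family_axioms.intro)
      fix v p
      show "mult_seminorm (n v)" unfolding n_def
        using c F.class_ring_hom_axioms by (intro real_valuation.mult_seminorm_abs) (auto simp: val_extensions_def)
      show "n v (Poly_Mapping.single 0 p) = n\<^sub>0 p"
        using c[of v] by (simp add: n_def n\<^sub>0_def ev\<^sub>R_const val_extensions_def extends_val_def val_restrict_def \<sigma>_def)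
    qed
    have n_null: "n v p = 0" if "ev\<^sub>R p = \<zero>\<^bsub>R\<^esub>" for v p
      using c[of v] that by (simp add: n_def val_extensions_def real_valuation.val_zero abs_of_val_def)
    have smult: "\<sigma> a \<otimes>\<^bsub>R\<^esub> r = a \<odot>\<^bsub>R\<^esub> r" if "a \<in> carrier k" "r \<in> carrier R" for a r
      using that by (simp add: \<sigma>_def structure_map_def R.smult_assoc2)
    have R_rel: "n v (var (r \<oplus>\<^bsub>R\<^esub> s) - (var r + var s)) = 0"
      "n v (var (r \<otimes>\<^bsub>R\<^esub> s) - var r * var s) = 0" "n v (var \<one>\<^bsub>R\<^esub> - 1) = 0"
      "n v (var (a \<odot>\<^bsub>R\<^esub> r) - Poly_Mapping.single 0 (var a) * var r) = 0"
      if "r \<in> carrier R" "s \<in> carrier R" "a \<in> carrier k" for r s a v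
      using that by (auto intro!: n_null simp: F.diff F.add F.mult ev\<^sub>R_var ev\<^sub>R_const ev\<^sub>k_var smult R.minus_eq R.r_neg)
    obtain M where M: "mult_seminorm M" and M_const: "\<And>a. M (Poly_Mapping.single 0 a) = n\<^sub>0 a"
      and M_index: "\<And>v z. M (index_poly v z) = n v z" using amalgamation by blast
    define j where "j p = (Poly_Mapping.single 0 p :: (('b \<Rightarrow> ereal) \<times> 'b \<Rightarrow>\<^sub>0 nat) \<Rightarrow>\<^sub>0 (('a \<Rightarrow>\<^sub>0 nat) \<Rightarrow>\<^sub>0 int))" for p
    have M_j: "M (j p) = n\<^sub>0 p" for p by (simp add: j_def M_const)
    have j: "j p - j q = j (p - q)" "j p + j q = j (p + q)" "j p * j q = j (p * q)" "1 = j 1"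
      "j p = index_poly v (Poly_Mapping.single 0 p)" for p q v
      by (simp_all add: j_def single_diff single_add mult_single index_poly_single)
    have index_add: "index_poly v p + index_poly v q = index_poly v (p + q)" for v p q
      using index_poly_diff[of v "p + q" q] by simp
    note index = index_poly_diff[symmetric] index_add index_poly_mult[symmetric] M_index
    \<comment> \<open>Integral polynomials in both kinds of variables are regarded as polynomials in
      the \<open>y v r\<close> with coefficients in \<open>A\<close>; \<open>N\<close> is the
      pullback of \<open>M\<close> along this map.\<close>
    let ?\<theta> = "int_poly_eval (case_sum (\<lambda>a. j (var a)) (\<lambda>(v, r). index_poly v (var r)))"
    have \<theta>: "?\<theta> (x a) = j (var a)" "?\<theta> (y v r) = index_poly v (var r)" for a v r
      by (simp_all add: x_def y_def)
    note \<theta>_simps = int_poly_eval_diff int_poly_eval_add int_poly_eval_mult int_poly_eval_one \<theta>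
    show ?thesis
    proof (rule that[OF mult_seminorm_int_poly_eval[OF M, of "case_sum (\<lambda>a. j (var a)) (\<lambda>(v, r). index_poly v (var r))"]],
        unfold \<theta>_simps)
      fix a b assume "a \<in> carrier k" "b \<in> carrier k"
      then show "M (j (var (a \<oplus>\<^bsub>k\<^esub> b)) - (j (var a) + j (var b))) = 0"
        "M (j (var (a \<otimes>\<^bsub>k\<^esub> b)) - j (var a) * j (var b)) = 0"
        using k_rel by (simp_all only: j(1-3) M_j)
    next
      show "M (j (var \<one>\<^bsub>k\<^esub>) - 1) = 0"
        using k_one by (simp only: j(1,4) M_j)
    next
      fix a assume "a \<in> carrier k"
      then show "M (j (var a)) = abs_of_val (\<nu> a)" using k_rel by (simp only: M_j)
    next
      fix v r assume "v \<in> val_extensions k \<nu> R" "r \<in> carrier R"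
      then show "M (index_poly v (var r)) = abs_of_val (v r)"
        by (simp add: M_index n_def c_def ev\<^sub>R_var)
    next
      fix v r s assume "r \<in> carrier R" "s \<in> carrier R"
      then show "M (index_poly v (var (r \<oplus>\<^bsub>R\<^esub> s)) - (index_poly v (var r) + index_poly v (var s))) = 0"
        "M (index_poly v (var (r \<otimes>\<^bsub>R\<^esub> s)) - index_poly v (var r) * index_poly v (var s)) = 0"
        using R_rel(1,2)[OF _ _ k.zero_closed] by (simp_all only: index)
    next
      fix v
      show "M (index_poly v (var \<one>\<^bsub>R\<^esub>) - 1) = 0"
        using R_rel(3)[OF e\<^sub>R e\<^sub>R e\<^sub>k] by (simp only: index_poly_one[of v, symmetric] index)
    next
      \<comment> \<open>Here tensoring over \<open>A\<close> matters: the constant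
        \<open>j (var a)\<close> also lies in the \<open>v\<close>-th copy, so the relation can be
        checked there with \<open>n v\<close>.\<close>
      fix v a r assume "a \<in> carrier k" "r \<in> carrier R"
      then show "M (index_poly v (var (a \<odot>\<^bsub>R\<^esub> r)) - j (var a) * index_poly v (var r)) = 0"
        using R_rel(4)[OF _ e\<^sub>R] by (simp only: j(5)[of _ v] index)
    qed
  qed
  interpret N: mult_seminorm N by (rule N)
  let ?K = "N.quotient_algebra x"
  show ?thesis
  proof (intro exI conjI ballI)
    show "algebra k ?K" using assms(1) N_k(2-4) by (rule N.algebra_quotient)
    show "real_valuation ?K N.quotient_val" by (rule N.real_valuation_quotient)
    have "structure_map ?K a = N.coset (x a)" for a
      by (simp add: structure_map_def N.quotient_algebra_def N.quotient_simps)
    then show "extends_val k \<nu> ?K N.quotient_val"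
      by (simp add: extends_val_def val_restrict_def N.quotient_val_coset N_k(1) val_of_abs_of_val k.val_not_MInf)
    fix v assume v: "v \<in> val_extensions k \<nu> R"
    show "\<exists>f\<in>algebra_hom k R ?K. \<forall>r\<in>carrier R. v r = (N.quotient_val \<circ> f) r"
    proof (intro bexI ballI)
      show "(\<lambda>r. N.coset (y v r)) \<in> algebra_hom k R ?K"
        using N_R(2-5)[OF v] by (rule N.quotient_algebra_hom)
      fix r assume r: "r \<in> carrier R"
      have "v r \<noteq> - \<infinity>" using v r real_valuation.val_not_MInf[of R v r] by (auto simp: val_extensions_def)
      then show "v r = (N.quotient_val \<circ> (\<lambda>r. N.coset (y v r))) r"
        by (simp add: N.quotient_val_coset N_R(1)[OF v r] val_of_abs_of_val)
    qed
  qed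
qed

end
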